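(* Let $\mathcal{E}\in\mathcal{C}(\mathbb{R}^d)$ satisfy the following two conditions. (A1) There exists $v^*\in\mathbb{R}^d$ such that $\mathcal{E}(v^* )=\inf_{v\in\mathbb{R}^d}\mathcal{E}(v)=:\underline{\mathcal{E}}$. (A2) There exist $\mathcal{E}_\infty,R_0,\eta>0$ and $\nu\in(0,\infty)$ such that $$\|v-v^*\|_2\le \frac{(\mathcal{E}(v)-\underline{\mathcal{E}})^{\nu}}{\eta}\quad\text{for all } v\in B_{R_0}(v^* ),\qquad \mathcal{E}(v)-\underline{\mathcal{E}}>\mathcal{E}_\infty\quad\text{for all } v\in (B_{R_0}(v^* ))^c$$ (the choice $R_0=\infty$ is allowed, in which case $B_{R_0}(v^* )=\mathbb{R}^d$ and the second condition is void). Let $\rho_0\in\mathcal{P}_4(\mathbb{R}^d)$ with $v^*\in\operatorname{supp}(\rho_0)$, and write $\mathcal{V}(\varrho):=\frac12\int\|v-v^*\|_2^2\,d\varrho(v)$. Fix any $\varepsilon\in(0,\mathcal{V}(\rho_0))$ and $\vartheta\in(0,1)$, choose $\lambda,\sigma>0$ with $2\lambda>d\sigma^2$, and define $$T^*:=\frac{1}{(1-\vartheta)(2\lambda-d\sigma^2)}\log\left(\frac{\mathcal{V}(\rho_0)}{\varepsilon}\right).$$ Let $H\equiv1$. Then there exists $\alpha_0>0$, depending (among problem-dependent quantities) on $\varepsilon$ and $\vartheta$, such that for all $\alpha>\alpha_0$ the following holds: if $\rho\in\mathcal{C}([0,T^*],\mathcal{P}_4(\mathbb{R}^d))$ is a weak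 solution on $[0,T^*]$ with initial condition $\rho_0$ to the Fokker–Planck equation $$\partial_t\rho_t=\lambda\,\mathrm{div}\big((v-v_\alpha(\rho_t))H(\mathcal{E}(v)-\mathcal{E}(v_\alpha(\rho_t)))\rho_t\big)+\frac{\sigma^2}{2}\Delta\big(\|v-v_\alpha(\rho_t)\|_2^2\rho_t\big),$$ then there is a time $$T\in\left[\frac{1-\vartheta}{1+\vartheta/2}\,T^*,\,T^*\right]\quad\text{with}\quad \mathcal{V}(\rho_T)=\varepsilon,$$ and for all $t\in[0,T]$ $$W_2^2(\rho_t,\delta_{v^*})=2\mathcal{V}(\rho_t)\le 2\mathcal{V}(\rho_0)\exp\big(-(1-\vartheta)(2\lambda-d\sigma^2)t\big).$$ Moreover, if $\mathcal{E}$ additionally satisfies (A3) there exist $L_{\mathcal{E}}>0$ and $\gamma\ge0$ such that $\mathcal{E}(v)-\underline{\mathcal{E}}\le L_{\mathcal{E}}(1+\|v-v^*\|_2^\gamma)\|v-v^*\|_2$ for all $v\in\mathbb{R}^d$, then the same conclusion holds for the Fokker–Planck equation $$\partial_t\rho_t=\lambda\,\mathrm{div}\big((v-v_\alpha(\rho_t))H(\mathcal{E}(v)-\mathcal{E}(v_\alpha(\rho_t)))\rho_t\big)+\frac{\sigma^2}{2}\Delta\big(\|v-v_\alpha(\rho_t)\|_2^2\rho_t\big)$$ with any $H:\mathbb{R}\to[0,1]$ that satisfies $H(x)=1$ whenever $x\ge0$.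
   Context: Notation: $\|\cdot\|_2$ is the Euclidean norm, $B_r(u)=\{v\in\mathbb{R}^d:\|v-u\|_2\le r\}$, $\mathcal{P}(\mathbb{R}^d)$ is the set of Borel probability measures on $\mathbb{R}^d$, $\mathcal{P}_p(\mathbb{R}^d)$ those with finite $p$-th moment, $W_p$ is the Wasserstein-$p$ distance, and $\mathcal{C}([0,T],\mathcal{P}_4(\mathbb{R}^d))$ is the set of continuous curves in $\mathcal{P}_4(\mathbb{R}^d)$ (equipped with $W_4$). For $\alpha>0$ and $\varrho\in\mathcal{P}(\mathbb{R}^d)$ the consensus point is $$v_\alpha(\varrho):=\int v\,\frac{\omega_\alpha(v)}{\|\omega_\alpha\|_{L_1(\varrho)}}\,d\varrho(v),\qquad \omega_\alpha(v):=\exp(-\alpha\mathcal{E}(v)),\qquad \|\omega_\alpha\|_{L_1(\varrho)}=\int\omega_\alpha\,d\varrho.$$ Weak solution: $\rho\in\mathcal{C}([0,T],\mathcal{P}(\mathbb{R}^d))$ satisfies the Fokker–Planck equation with initial condition $\rho_0$ in the weak sense on $[0,T]$ if for all $\phi\in\mathcal{C}_c^\infty(\mathbb{R}^d)$ and all $t\in(0,T)$ $$\frac{d}{dt}\int\phi\,d\rho_t=-\lambda\int H(\mathcal{E}(v)-\mathcal{E}(v_\alpha(\rho_t)))\langle v-v_\alpha(\rho_t),\nabla\phi(v)\rangle\,d\rho_t(v)+\frac{\sigma^2}{2}\int\|v-v_\alpha(\rho_t)\|_2^2\,\Delta\phi(v)\,d\rho_t(v)$$ and $\lim_{t\to0}\rho_t=\rho_0$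 pointwise. If $\rho\in\mathcal{C}([0,T],\mathcal{P}_4(\mathbb{R}^d))$, the identity is used for all $\phi\in\mathcal{C}^2(\mathbb{R}^d)$ with $\sup_v|\Delta\phi(v)|<\infty$ and $\|\nabla\phi(v)\|_2\le C(1+\|v\|_2)$ for some $C>0$. *)

theory Defs
  imports "HOL-Probability.Probability"
begin

section \<open>Probability measures and Wasserstein distances\<close>

definition prob_measures_p :: "nat \<Rightarrow> ('a::euclidean_space) measure set" where
  "prob_measures_p p =
     {\<mu>. prob_space \<mu> \<and> sets \<mu> = sets borel \<and> integrable \<mu> (\<lambda>v. norm v ^ p)}"

definition measure_support :: "('a::metric_space) measure \<Rightarrow> 'a set" where
  "measure_support \<mu> = {x. \<forall>r>0. emeasure \<mu> (ball x r) > 0}"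

definition couplings ::
    "('a::euclidean_space) measure \<Rightarrow> 'a measure \<Rightarrow> ('a \<times> 'a) measure set" where
  "couplings \<mu> \<nu> =
     {\<pi>. sets \<pi> = sets borel \<and> distr \<pi> borel fst = \<mu> \<and> distr \<pi> borel snd = \<nu>}"

text \<open>The transport cost is finite for \<open>\<mu>\<close>, \<open>\<nu>\<close> with finite \<open>p\<close>-th moment; only then is the
  conversion to a real number meaningful.\<close>

definition wasserstein :: "nat \<Rightarrow> ('a::euclidean_space) measure \<Rightarrow> 'a measure \<Rightarrow> real" where
  "wasserstein p \<mu> \<nu> =
     root p (enn2real (INF \<pi>\<in>couplings \<mu> \<nu>. \<integral>\<^sup>+ z. ennreal (norm (fst z - snd z) ^ p) \<partial>\<pi>))"

definition wasserstein_curves :: "nat \<Rightarrow> real \<Rightarrow> (real \<Rightarrow> ('a::euclidean_space) measure) set" where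
  "wasserstein_curves p T =
     {\<rho>. \<forall>t\<in>{0..T}. \<rho> t \<in> prob_measures_p p \<and>
           ((\<lambda>s. wasserstein p (\<rho> s) (\<rho> t)) \<longlongrightarrow> 0) (at t within {0..T})}"

definition half_second_moment :: "'a::euclidean_space \<Rightarrow> 'a measure \<Rightarrow> real" where
  "half_second_moment vs \<mu> = 1/2 * (\<integral>v. (norm (v - vs))\<^sup>2 \<partial>\<mu>)"


section \<open>The objective function\<close>

text \<open>Boundedness below is part of the assertion that the infimum is attained:
  for an unbounded set of reals, \<open>INF\<close> is an unspecified number.\<close>

definition cond_A1 :: "(real^'n \<Rightarrow> real) \<Rightarrow> real^'n \<Rightarrow> bool" where
  "cond_A1 E vs \<longleftrightarrow> bdd_below (range E) \<and> E vs = (INF v. E v)"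

text \<open>The radius is extended real, so that \<open>R0 = \<infinity>\<close> is allowed.\<close>

definition cond_A2 :: "(real^'n \<Rightarrow> real) \<Rightarrow> real^'n \<Rightarrow> bool" where
  "cond_A2 E vs \<longleftrightarrow>
     (\<exists>(Einf::real) (R0::ereal) (\<eta>::real) (\<nu>::real).
        Einf > 0 \<and> R0 > 0 \<and> \<eta> > 0 \<and> \<nu> > 0 \<and>
        (\<forall>v. ereal (norm (v - vs)) \<le> R0 \<longrightarrow>
             norm (v - vs) \<le> (E v - (INF u. E u)) powr \<nu> / \<eta>) \<and>
        (\<forall>v. \<not> ereal (norm (v - vs)) \<le> R0 \<longrightarrow> E v - (INF u. E u) > Einf))"

text \<open>The convention \<open>0 powr 0 = 0\<close> is harmless here because of the last factor.\<close>

definition cond_A3 :: "(real^'n \<Rightarrow> real) \<Rightarrow> real^'n \<Rightarrow> bool" where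
  "cond_A3 E vs \<longleftrightarrow>
     (\<exists>L \<gamma>. L > 0 \<and> \<gamma> \<ge> 0 \<and>
        (\<forall>v. E v - (INF u. E u) \<le> L * (1 + norm (v - vs) powr \<gamma>) * norm (v - vs)))"

definition gibbs_weight :: "(real^'n \<Rightarrow> real) \<Rightarrow> real \<Rightarrow> real^'n \<Rightarrow> real" where
  "gibbs_weight E \<alpha> v = exp (- \<alpha> * E v)"

definition consensus_point ::
    "(real^'n \<Rightarrow> real) \<Rightarrow> real \<Rightarrow> (real^'n) measure \<Rightarrow> real^'n" where
  "consensus_point E \<alpha> \<mu> =
     (\<integral>v. (gibbs_weight E \<alpha> v / (\<integral>w. gibbs_weight E \<alpha> w \<partial>\<mu>)) *\<^sub>R v \<partial>\<mu>)"


section \<open>Weak solutions of the Fokker--Planck equation\<close>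

definition gradient :: "(real^'n \<Rightarrow> real) \<Rightarrow> real^'n \<Rightarrow> real^'n" where
  "gradient \<phi> v = (\<chi> i. frechet_derivative \<phi> (at v) (axis i 1))"

definition hessian :: "(real^'n \<Rightarrow> real) \<Rightarrow> real^'n \<Rightarrow> real^'n^'n" where
  "hessian \<phi> v = jacobian (gradient \<phi>) (at v)"

definition laplacian :: "(real^'n \<Rightarrow> real) \<Rightarrow> real^'n \<Rightarrow> real" where
  "laplacian \<phi> v = trace (hessian \<phi> v)"

definition C2_functions :: "(real^'n \<Rightarrow> real) set" where
  "C2_functions =
     {\<phi>. (\<forall>v. \<phi> differentiable (at v)) \<and> (\<forall>v. gradient \<phi> differentiable (at v)) \<and>
         continuous_on UNIV (hessian \<phi>)}"

definition test_functions :: "(real^'n \<Rightarrow> real) set" where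
  "test_functions =
     {\<phi>\<in>C2_functions.
        bounded (range (laplacian \<phi>)) \<and> (\<exists>C>0. \<forall>v. norm (gradient \<phi> v) \<le> C * (1 + norm v))}"

text \<open>The integrability clause says that the drift term is well defined. It holds automatically
  when \<open>H\<close> is Borel measurable, but measurability of \<open>H\<close> is not assumed; all other integrals exist
  for continuous \<open>E\<close> bounded below. The initial condition is convergence of \<open>\<rho> t\<close> to \<open>\<rho>0\<close>
  pointwise on test functions.\<close>

definition fokker_planck_weak_solution ::
    "(real^'n \<Rightarrow> real) \<Rightarrow> (real \<Rightarrow> real) \<Rightarrow> real \<Rightarrow> real \<Rightarrow> real \<Rightarrow> real \<Rightarrow>
     (real^'n) measure \<Rightarrow> (real \<Rightarrow> (real^'n) measure) \<Rightarrow> bool" where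
  "fokker_planck_weak_solution E H \<alpha> lam \<sigma> T \<rho>0 \<rho> \<longleftrightarrow>
     \<rho> \<in> wasserstein_curves 4 T \<and>
     (\<forall>\<phi>\<in>test_functions.
        (\<forall>t\<in>{0<..<T}.
           integrable (\<rho> t) (\<lambda>v. H (E v - E (consensus_point E \<alpha> (\<rho> t))) *
                                ((v - consensus_point E \<alpha> (\<rho> t)) \<bullet> gradient \<phi> v)) \<and>
           ((\<lambda>s. \<integral>v. \<phi> v \<partial>(\<rho> s)) has_real_derivative
              - lam * (\<integral>v. H (E v - E (consensus_point E \<alpha> (\<rho> t))) *
                            ((v - consensus_point E \<alpha> (\<rho> t)) \<bullet> gradient \<phi> v) \<partial>(\<rho> t))
              + \<sigma>\<^sup>2 / 2 * (\<integral>v. (norm (v - consensus_point E \<alpha> (\<rho> t)))\<^sup>2 * laplacian \<phi> v \<partial>(\<rho> t)))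
            (at t)) \<and>
        ((\<lambda>t. \<integral>v. \<phi> v \<partial>(\<rho> t)) \<longlongrightarrow> (\<integral>v. \<phi> v \<partial>\<rho>0)) (at_right 0))"

end

theory Submission
  imports Defs
begin

text \<open>The second moment \<open>V t\<close> about \<open>vs\<close> obeys \<open>V' = - \<kappa> * V\<close> with \<open>\<kappa> = 2 * lam - d * \<sigma>\<^sup>2\<close>, up to an
  error that is small as long as the consensus point is close to \<open>vs\<close>. By the Laplace principle it is
  close for large \<open>\<alpha>\<close>, provided that the measure keeps some mass near \<open>vs\<close>; and it does, because
  the generator applied to the bump \<open>(1 - |v - vs|\<^sup>2 / r\<^sup>2)\<^sup>3\<close> is at least \<open>- p\<close> times the bump while
  the consensus point stays bounded. These two dependencies are closed by a continuity argument in
  time for the mass and \<open>V\<close>, which needs no regularity of the consensus point.\<close>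

section \<open>Moments and Wasserstein distances\<close>

text \<open>Near the edge of its support the bump u^3 is much smaller than its drift term, which is
  of order u^2, so the bump cannot dominate the drift directly. The diffusion term has the good sign
  there and is of order u, but it degenerates at the consensus point e, where its factor |v - e|^2
  vanishes. The drift also carries a factor |v - e|, though, and completing the square in it leaves
  an error of order u^3 only.

  The resulting rate p depends on the radius r and on a bound for |e - vs|, but not on \<alpha>, H
  or the solution. This makes a non-circular choice of constants possible: the error budget and E
  determine the tolerance \<delta> for |e - vs|, then r, then p, then the mass bound m, and \<alpha>
  comes last.

  The error in V' is an absolute one, whereas the decay rates are relative to V; as long as V
  exceeds \<epsilon>, the former is a fraction of the latter.\<close>

lemma prob_measures_p_D:
  assumes "\<mu> \<in> prob_measures_p p"
  shows "prob_space \<mu>" "sets \<mu> = sets borel" "space \<mu> = UNIV" "integrable \<mu> (\<lambda>v. norm v ^ p)"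
  using assms sets_eq_imp_space_eq[of \<mu> borel] by (auto simp: prob_measures_p_def)

lemma continuous_imp_measurable_sets_borel:
  fixes f :: "'a::topological_space \<Rightarrow> 'b::topological_space"
  assumes "sets \<mu> = sets borel" "continuous_on UNIV f"
  shows "f \<in> borel_measurable \<mu>"
  using borel_measurable_continuous_onI[OF assms(2)] measurable_cong_sets[OF assms(1) refl, of borel]
  by auto

lemma power4_sum_le:
  fixes a b :: real
  assumes "a \<ge> 0" "b \<ge> 0"
  shows "(a + b) ^ 4 \<le> 16 * (a ^ 4 + b ^ 4)"
proof -
  have "(a + b) ^ 4 \<le> (2 * max a b) ^ 4"
    using assms by (intro power_mono) auto
  also have "\<dots> = 16 * max a b ^ 4" by simp
  also have "\<dots> \<le> 16 * (a ^ 4 + b ^ 4)"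
    using assms by (auto simp: max_def)
  finally show ?thesis .
qed

lemma self_le_one_plus_power2: "x \<le> 1 + x\<^sup>2" for x :: real
proof -
  have "0 \<le> (x - 1)\<^sup>2 + x\<^sup>2 + 1" by simp
  then show ?thesis by (simp add: power2_diff)
qed

lemma integrable_norm_diff_power2:
  fixes \<mu> :: "('a::euclidean_space) measure"
  assumes "\<mu> \<in> prob_measures_p 4"
  shows "integrable \<mu> (\<lambda>v. (norm (v - a))\<^sup>2)"
proof -
  interpret prob_space \<mu> using prob_measures_p_D[OF assms] by simp
  note * = prob_measures_p_D[OF assms]
  show ?thesis
  proof (rule Bochner_Integration.integrable_bound)
    show "integrable \<mu> (\<lambda>v. 1 + 16 * (norm v ^ 4 + norm a ^ 4))" using *(4) by auto
    show "(\<lambda>v. (norm (v - a))\<^sup>2) \<in> borel_measurable \<mu>"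
      by (rule continuous_imp_measurable_sets_borel[OF *(2)]) (intro continuous_intros)
    show "AE v in \<mu>. norm ((norm (v - a))\<^sup>2) \<le> norm (1 + 16 * (norm v ^ 4 + norm a ^ 4))"
    proof (rule AE_I2)
      fix v :: 'a
      have "(norm (v - a))\<^sup>2 \<le> 1 + ((norm (v - a))\<^sup>2)\<^sup>2"
        using self_le_one_plus_power2 .
      also have "((norm (v - a))\<^sup>2)\<^sup>2 = norm (v - a) ^ 4" by simp
      also have "norm (v - a) ^ 4 \<le> (norm v + norm a) ^ 4"
        by (intro power_mono norm_triangle_ineq4) auto
      also have "\<dots> \<le> 16 * (norm v ^ 4 + norm a ^ 4)"
        by (rule power4_sum_le) auto
      finally show "norm ((norm (v - a))\<^sup>2) \<le> norm (1 + 16 * (norm v ^ 4 + norm a ^ 4))"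
        by simp
    qed
  qed
qed

section \<open>Couplings and finiteness of the transport cost\<close>

lemma pair_measure_in_couplings:
  assumes "prob_space \<mu>" "prob_space \<nu>" "sets \<mu> = sets borel" "sets \<nu> = sets borel"
  shows "\<mu> \<Otimes>\<^sub>M \<nu> \<in> couplings \<mu> \<nu>"
proof -
  interpret \<mu>: prob_space \<mu> by fact
  interpret \<nu>: prob_space \<nu> by fact
  interpret pair_prob_space \<mu> \<nu> ..
  have s: "sets (\<mu> \<Otimes>\<^sub>M \<nu>) = sets borel"
    using assms(3,4) by (metis borel_prod sets_pair_measure_cong)
  have f: "distr (\<mu> \<Otimes>\<^sub>M \<nu>) borel fst = \<mu>"
    using \<nu>.distr_pair_fst[of \<mu>] assms(3) by (metis distr_cong)
  have "distr (\<mu> \<Otimes>\<^sub>M \<nu>) borel snd = \<nu>"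
  proof (rule measure_eqI)
    show "sets (distr (\<mu> \<Otimes>\<^sub>M \<nu>) borel snd) = sets \<nu>" using assms(4) by simp
    fix A :: "'a set" assume "A \<in> sets (distr (\<mu> \<Otimes>\<^sub>M \<nu>) borel snd)"
    then have A: "A \<in> sets \<nu>" using assms(4) by simp
    have m: "snd \<in> measurable (\<mu> \<Otimes>\<^sub>M \<nu>) borel"
      using measurable_snd[of \<mu> \<nu>] assms(4) by (metis measurable_cong_sets)
    have eq: "snd -` A \<inter> space (\<mu> \<Otimes>\<^sub>M \<nu>) = space \<mu> \<times> A"
      using sets.sets_into_space[OF A] by (auto simp: space_pair_measure)
    show "emeasure (distr (\<mu> \<Otimes>\<^sub>M \<nu>) borel snd) A = emeasure \<nu> A"
      using A assms(4) m by (simp add: emeasure_distr eq \<nu>.emeasure_pair_measure_Times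
          \<mu>.emeasure_space_1)
  qed
  then show ?thesis using s f by (simp add: couplings_def)
qed

lemma couplings_measurable:
  assumes "\<pi> \<in> couplings \<mu> \<nu>"
  shows "fst \<in> borel_measurable \<pi>" "snd \<in> borel_measurable \<pi>"
    "distr \<pi> borel fst = \<mu>" "distr \<pi> borel snd = \<nu>" "sets \<pi> = sets borel"
proof -
  show s: "sets \<pi> = sets borel" using assms by (simp add: couplings_def)
  show "fst \<in> borel_measurable \<pi>" "snd \<in> borel_measurable \<pi>"
    by (auto intro!: continuous_imp_measurable_sets_borel[OF s] continuous_intros)
  show "distr \<pi> borel fst = \<mu>" "distr \<pi> borel snd = \<nu>"
    using assms by (auto simp: couplings_def)
qed

text \<open>\<open>enn2real\<close> sends \<infinity> to 0, so a small value of
  \<open>wasserstein\<close> bounds the cost only once the cost is known to be finite. The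
  independent coupling supplies this.\<close>

lemma wasserstein_4_cost_finite:
  assumes "\<mu> \<in> prob_measures_p 4" "\<nu> \<in> prob_measures_p 4"
  shows "(INF \<pi>\<in>couplings \<mu> \<nu>. \<integral>\<^sup>+ z. ennreal (norm (fst z - snd z) ^ 4) \<partial>\<pi>) < \<infinity>"
proof -
  note \<mu> = prob_measures_p_D[OF assms(1)] and \<nu> = prob_measures_p_D[OF assms(2)]
  let ?\<pi> = "\<mu> \<Otimes>\<^sub>M \<nu>"
  have c: "?\<pi> \<in> couplings \<mu> \<nu>"
    using pair_measure_in_couplings[OF \<mu>(1) \<nu>(1) \<mu>(2) \<nu>(2)] .
  note m = couplings_measurable[OF c]
  have "integrable (distr ?\<pi> borel fst) (\<lambda>v. norm v ^ 4)" using \<mu>(4) m(3) by simp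
  then have 1: "integrable ?\<pi> (\<lambda>z. norm (fst z) ^ 4)"
    by (rule integrable_distr[OF m(1)])
  have "integrable (distr ?\<pi> borel snd) (\<lambda>v. norm v ^ 4)" using \<nu>(4) m(4) by simp
  then have 2: "integrable ?\<pi> (\<lambda>z. norm (snd z) ^ 4)"
    by (rule integrable_distr[OF m(2)])
  have i: "integrable ?\<pi> (\<lambda>z. 16 * (norm (fst z) ^ 4 + norm (snd z) ^ 4))"
    using 1 2 by auto
  have "(INF \<pi>\<in>couplings \<mu> \<nu>. \<integral>\<^sup>+ z. ennreal (norm (fst z - snd z) ^ 4) \<partial>\<pi>)
      \<le> (\<integral>\<^sup>+ z. ennreal (norm (fst z - snd z) ^ 4) \<partial>?\<pi>)"
    using c by (rule INF_lower)
  also have "\<dots> \<le> (\<integral>\<^sup>+ z. ennreal (16 * (norm (fst z) ^ 4 + norm (snd z) ^ 4)) \<partial>?\<pi>)"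
  proof (intro nn_integral_mono ennreal_leI)
    fix z :: "'a \<times> 'a"
    have "norm (fst z - snd z) ^ 4 \<le> (norm (fst z) + norm (snd z)) ^ 4"
      by (intro power_mono norm_triangle_ineq4) auto
    also have "\<dots> \<le> 16 * (norm (fst z) ^ 4 + norm (snd z) ^ 4)"
      by (rule power4_sum_le) auto
    finally show "norm (fst z - snd z) ^ 4 \<le> 16 * (norm (fst z) ^ 4 + norm (snd z) ^ 4)" .
  qed
  also have "\<dots> < \<infinity>"
    using nn_integral_eq_integral[OF i] by simp
  finally show ?thesis .
qed

text \<open>Young's inequality, applied twice, raises |a - b| to the fourth power, which is the cost
  in \<open>wasserstein 4\<close>, and leaves an arbitrarily small multiple of the rest. The
  right-hand side contains \<open>norm b\<close> but not \<open>norm a\<close>, so that only the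
  moment of the fixed measure enters a limit.\<close>

lemma abs_diff_norm_power2_le:
  fixes a b :: "'a::real_inner"
  assumes "\<eta> > 0"
  shows "\<bar>(norm a)\<^sup>2 - (norm b)\<^sup>2\<bar> \<le>
    (1 + 1/\<eta>)\<^sup>2 / (4 * \<eta>) * norm (a - b) ^ 4 + \<eta> * (1 + (norm b)\<^sup>2)"
proof -
  define D where "D = norm (a - b)"
  have D: "D \<ge> 0" by (simp add: D_def)
  have t: "\<bar>norm a - norm b\<bar> \<le> D" unfolding D_def by (rule norm_triangle_ineq3)
  have "\<bar>(norm a)\<^sup>2 - (norm b)\<^sup>2\<bar> = \<bar>norm a - norm b\<bar> * (norm a + norm b)"
    by (simp add: power2_eq_square square_diff_square_factored abs_mult)
  also have "\<dots> \<le> D * (D + 2 * norm b)"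
    using t D by (intro mult_mono) auto
  also have "\<dots> \<le> (1 + 1/\<eta>) * D\<^sup>2 + \<eta> * (norm b)\<^sup>2"
  proof -
    have "0 \<le> (D - \<eta> * norm b)\<^sup>2 / \<eta>" using assms by simp
    also have "\<dots> = D\<^sup>2 / \<eta> - 2 * D * norm b + \<eta> * (norm b)\<^sup>2"
      using assms by (simp add: field_simps power2_eq_square)
    finally show ?thesis by (simp add: algebra_simps power2_eq_square)
  qed
  also have "(1 + 1/\<eta>) * D\<^sup>2 \<le> (1 + 1/\<eta>)\<^sup>2 / (4 * \<eta>) * D ^ 4 + \<eta>"
  proof -
    define k where "k = (1 + 1/\<eta>) * D\<^sup>2"
    have "0 \<le> (k - 2 * \<eta>)\<^sup>2 / (4 * \<eta>)" using assms by simp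
    also have "\<dots> = k\<^sup>2 / (4 * \<eta>) - k + \<eta>"
      using assms by (simp add: field_simps power2_eq_square)
    finally show ?thesis by (simp add: k_def power_mult_distrib)
  qed
  finally show ?thesis by (simp add: D_def algebra_simps)
qed

text \<open>Because the bound on the distance is strict, some coupling has cost below
  \<open>\<omega> ^ 4\<close>; the pointwise estimate is integrated against it.\<close>

lemma half_second_moment_diff_le:
  assumes \<mu>: "\<mu> \<in> prob_measures_p 4" and \<nu>: "\<nu> \<in> prob_measures_p 4"
    and \<eta>: "\<eta> > 0" and \<omega>: "\<omega> > 0" and w: "wasserstein 4 \<mu> \<nu> < \<omega>"
  shows "\<bar>half_second_moment vs \<mu> - half_second_moment vs \<nu>\<bar> \<le>
    (1 + 1/\<eta>)\<^sup>2 / (8 * \<eta>) * \<omega> ^ 4 + \<eta> * (1/2 + half_second_moment vs \<nu>)"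
proof -
  let ?I = "INF \<pi>\<in>couplings \<mu> \<nu>. \<integral>\<^sup>+ z. ennreal (norm (fst z - snd z) ^ 4) \<partial>\<pi>"
  have fin: "?I < \<infinity>" by (rule wasserstein_4_cost_finite[OF \<mu> \<nu>])
  have "root 4 (enn2real ?I) < root 4 (\<omega> ^ 4)"
    using w \<omega> by (simp add: wasserstein_def real_root_power_cancel)
  then have "enn2real ?I < \<omega> ^ 4" by simp
  then have "ennreal (enn2real ?I) < ennreal (\<omega> ^ 4)"
    using \<omega> by (intro ennreal_lessI) auto
  moreover have "ennreal (enn2real ?I) = ?I"
    using fin by (intro ennreal_enn2real) auto
  ultimately have "?I < ennreal (\<omega> ^ 4)" by simp
  then obtain \<pi> where \<pi>: "\<pi> \<in> couplings \<mu> \<nu>"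
    and cost: "(\<integral>\<^sup>+ z. ennreal (norm (fst z - snd z) ^ 4) \<partial>\<pi>) < ennreal (\<omega> ^ 4)"
    by (auto simp: INF_less_iff)
  note m = couplings_measurable[OF \<pi>]
  have "prob_space (distr \<pi> borel fst)" using prob_measures_p_D[OF \<mu>] m(3) by simp
  then interpret prob_space \<pi> by (rule prob_space_distrD[OF m(1)])
  have i4: "integrable \<pi> (\<lambda>z. norm (fst z - snd z) ^ 4)"
  proof (rule integrableI_bounded)
    show "(\<lambda>z. norm (fst z - snd z) ^ 4) \<in> borel_measurable \<pi>"
      by (rule continuous_imp_measurable_sets_borel[OF m(5)]) (intro continuous_intros)
    show "(\<integral>\<^sup>+ z. ennreal (norm (norm (fst z - snd z) ^ 4)) \<partial>\<pi>) < \<infinity>"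
      using less_trans[OF cost ennreal_less_top] by simp
  qed
  have c4: "(\<integral>z. norm (fst z - snd z) ^ 4 \<partial>\<pi>) \<le> \<omega> ^ 4"
    using cost \<omega> nn_integral_eq_integral[OF i4] by (simp add: ennreal_less_iff)
  have meas: "(\<lambda>v. (norm (v - vs))\<^sup>2) \<in> borel_measurable borel" by measurable
  have i1: "integrable \<pi> (\<lambda>z. (norm (fst z - vs))\<^sup>2)"
    using integrable_norm_diff_power2[OF \<mu>, of vs] integrable_distr_eq[OF m(1) meas] m(3) by simp
  have i2: "integrable \<pi> (\<lambda>z. (norm (snd z - vs))\<^sup>2)"
    using integrable_norm_diff_power2[OF \<nu>, of vs] integrable_distr_eq[OF m(2) meas] m(4) by simp
  have e1: "half_second_moment vs \<mu> = 1/2 * (\<integral>z. (norm (fst z - vs))\<^sup>2 \<partial>\<pi>)"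
    using integral_distr[OF m(1) meas] m(3) by (simp add: half_second_moment_def)
  have e2: "half_second_moment vs \<nu> = 1/2 * (\<integral>z. (norm (snd z - vs))\<^sup>2 \<partial>\<pi>)"
    using integral_distr[OF m(2) meas] m(4) by (simp add: half_second_moment_def)
  let ?C = "(1 + 1/\<eta>)\<^sup>2 / (4 * \<eta>)"
  have C: "?C \<ge> 0" using \<eta> by simp
  have "\<bar>\<integral>z. (norm (fst z - vs))\<^sup>2 - (norm (snd z - vs))\<^sup>2 \<partial>\<pi>\<bar>
      \<le> (\<integral>z. \<bar>(norm (fst z - vs))\<^sup>2 - (norm (snd z - vs))\<^sup>2\<bar> \<partial>\<pi>)"
    by (rule integral_abs_bound)
  also have "\<dots> \<le> (\<integral>z. ?C * norm (fst z - snd z) ^ 4 + \<eta> * (1 + (norm (snd z - vs))\<^sup>2) \<partial>\<pi>)"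
  proof (rule integral_mono)
    fix z
    show "\<bar>(norm (fst z - vs))\<^sup>2 - (norm (snd z - vs))\<^sup>2\<bar>
      \<le> ?C * norm (fst z - snd z) ^ 4 + \<eta> * (1 + (norm (snd z - vs))\<^sup>2)"
      using abs_diff_norm_power2_le[OF \<eta>, of "fst z - vs" "snd z - vs"] by simp
  qed (use i1 i2 i4 in auto)
  also have "\<dots> = ?C * (\<integral>z. norm (fst z - snd z) ^ 4 \<partial>\<pi>)
      + \<eta> * (1 + (\<integral>z. (norm (snd z - vs))\<^sup>2 \<partial>\<pi>))"
    using i2 i4 by (simp add: prob_space)
  also have "\<dots> \<le> ?C * \<omega> ^ 4 + \<eta> * (1 + (\<integral>z. (norm (snd z - vs))\<^sup>2 \<partial>\<pi>))"
    using mult_left_mono[OF c4 C] by simp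
  finally show ?thesis
    using i1 i2 by (simp add: e1 e2 field_simps abs_le_iff)
qed

lemma half_second_moment_nonneg: "half_second_moment vs \<mu> \<ge> 0"
  by (simp add: half_second_moment_def)

lemma tendsto_half_second_moment:
  assumes \<rho>: "\<rho> \<in> wasserstein_curves 4 T" and t: "t \<in> {0..T}"
  shows "((\<lambda>s. half_second_moment vs (\<rho> s)) \<longlongrightarrow> half_second_moment vs (\<rho> t))
    (at t within {0..T})"
proof (rule tendstoI)
  fix e :: real assume e: "e > 0"
  let ?V = "half_second_moment vs (\<rho> t)"
  \<comment> \<open>Each of the two terms in \<open>half_second_moment_diff_le\<close> is to be e/4.
    The choice of \<eta> comes first, since the coefficient \<open>C\<close> of
    \<open>\<omega> ^ 4\<close> depends on it.\<close>
  define \<eta> where "\<eta> = e / (4 * (1/2 + ?V))"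
  have V: "?V \<ge> 0" by (rule half_second_moment_nonneg)
  have \<eta>: "\<eta> > 0" using e V by (simp add: \<eta>_def add_pos_nonneg)
  have \<eta>V: "\<eta> * (1/2 + ?V) = e/4" using V by (simp add: \<eta>_def field_simps)
  define C where "C = (1 + 1/\<eta>)\<^sup>2 / (8 * \<eta>)"
  have "1 + 1/\<eta> > 0" using \<eta> by (simp add: add_pos_pos)
  then have C: "C > 0" using \<eta> by (simp add: C_def)
  define \<omega> where "\<omega> = root 4 (e / (4 * C))"
  have \<omega>: "\<omega> > 0" using e C by (simp add: \<omega>_def)
  have \<omega>4: "C * \<omega> ^ 4 = e/4" using e C by (simp add: \<omega>_def)
  have "((\<lambda>s. wasserstein 4 (\<rho> s) (\<rho> t)) \<longlongrightarrow> 0) (at t within {0..T})"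
    using \<rho> t by (auto simp: wasserstein_curves_def)
  then have "\<forall>\<^sub>F s in at t within {0..T}. wasserstein 4 (\<rho> s) (\<rho> t) < \<omega>"
    using \<omega> by (rule order_tendstoD)
  moreover have "\<forall>\<^sub>F s in at t within {0..T}. s \<in> {0..T}"
    by (simp add: eventually_at_filter)
  ultimately show "\<forall>\<^sub>F s in at t within {0..T}. dist (half_second_moment vs (\<rho> s)) ?V < e"
  proof eventually_elim
    case (elim s)
    have "\<rho> s \<in> prob_measures_p 4" "\<rho> t \<in> prob_measures_p 4"
      using \<rho> t elim by (auto simp: wasserstein_curves_def)
    from half_second_moment_diff_le[OF this \<eta> \<omega> elim(1), of vs]
    have "\<bar>half_second_moment vs (\<rho> s) - ?V\<bar> \<le> e/4 + e/4"
      unfolding C_def[symmetric] \<eta>V \<omega>4 .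
    then show ?case using e by (simp add: dist_real_def)
  qed
qed

text \<open>A coupling with a Dirac measure is concentrated on pairs with second component vs, so
  all couplings have the same cost and the infimum is over a constant.\<close>

lemma wasserstein_2_return:
  assumes \<mu>: "\<mu> \<in> prob_measures_p 4"
  shows "(wasserstein 2 \<mu> (return borel vs))\<^sup>2 = 2 * half_second_moment vs \<mu>"
proof -
  note * = prob_measures_p_D[OF \<mu>]
  let ?M = "\<integral>v. (norm (v - vs))\<^sup>2 \<partial>\<mu>"
  have i: "integrable \<mu> (\<lambda>v. (norm (v - vs))\<^sup>2)" by (rule integrable_norm_diff_power2[OF \<mu>])
  have cost: "(\<integral>\<^sup>+ z. ennreal (norm (fst z - snd z) ^ 2) \<partial>\<pi>) = ennreal ?M"
    if \<pi>: "\<pi> \<in> couplings \<mu> (return borel vs)" for \<pi>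
  proof -
    note m = couplings_measurable[OF \<pi>]
    have "AE v in distr \<pi> borel snd. v = vs"
      unfolding m(4) by (subst AE_return) auto
    then have "AE z in \<pi>. snd z = vs"
      using m(2) by (subst (asm) AE_distr_iff) auto
    then have "(\<integral>\<^sup>+ z. ennreal (norm (fst z - snd z) ^ 2) \<partial>\<pi>)
        = (\<integral>\<^sup>+ z. ennreal (norm (fst z - vs) ^ 2) \<partial>\<pi>)"
      by (intro nn_integral_cong_AE) auto
    also have "\<dots> = (\<integral>\<^sup>+ v. ennreal (norm (v - vs) ^ 2) \<partial>distr \<pi> borel fst)"
      using m(1) by (subst nn_integral_distr) auto
    also have "\<dots> = ennreal ?M"
      using m(3) nn_integral_eq_integral[OF i] by simp
    finally show ?thesis .
  qed
  have "\<mu> \<Otimes>\<^sub>M return borel vs \<in> couplings \<mu> (return borel vs)"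
    using * by (intro pair_measure_in_couplings prob_space_return) auto
  then have "couplings \<mu> (return borel vs) \<noteq> {}" by auto
  then have "(INF \<pi>\<in>couplings \<mu> (return borel vs). \<integral>\<^sup>+ z. ennreal (norm (fst z - snd z) ^ 2) \<partial>\<pi>)
      = ennreal ?M"
    using cost by (metis (no_types, lifting) INF_cong INF_const)
  then show ?thesis
    by (simp add: wasserstein_def half_second_moment_def)
qed

section \<open>Test functions\<close>

lemma gradient_eq:
  fixes \<phi> :: "real^'n \<Rightarrow> real"
  assumes "(\<phi> has_derivative (\<lambda>h. g \<bullet> h)) (at v)"
  shows "gradient \<phi> v = g"
  using frechet_derivative_at[OF assms, symmetric]
  by (simp add: gradient_def vec_eq_iff inner_axis)

lemma hessian_eq:
  fixes \<phi> :: "real^'n \<Rightarrow> real"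
  assumes "gradient \<phi> = G" "(G has_derivative (\<lambda>h. A *v h)) (at v)"
  shows "hessian \<phi> v = A"
  using frechet_derivative_at[OF assms(2), symmetric] assms(1)
  by (simp add: hessian_def jacobian_def)

lemma test_functionsI:
  fixes \<phi> :: "real^'n \<Rightarrow> real"
  assumes "\<And>v. (\<phi> has_derivative (\<lambda>h. G v \<bullet> h)) (at v)"
    and "\<And>v. (G has_derivative (\<lambda>h. A v *v h)) (at v)"
    and "continuous_on UNIV A"
    and "\<And>v. \<bar>trace (A v)\<bar> \<le> K"
    and "C > 0" "\<And>v. norm (G v) \<le> C * (1 + norm v)"
  shows "\<phi> \<in> test_functions" "gradient \<phi> = G" "laplacian \<phi> = (\<lambda>v. trace (A v))"
proof -
  show G: "gradient \<phi> = G" using gradient_eq[OF assms(1)] by auto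
  have H: "hessian \<phi> = A" using hessian_eq[OF G assms(2)] by auto
  show L: "laplacian \<phi> = (\<lambda>v. trace (A v))" by (auto simp: laplacian_def H)
  have "bounded (range (laplacian \<phi>))"
    using assms(4) by (auto simp: bounded_iff L)
  moreover have "\<phi> \<in> C2_functions"
    using assms(1,2,3) by (auto simp: C2_functions_def G H differentiable_def)
  ultimately show "\<phi> \<in> test_functions"
    using assms(5,6) by (auto simp: test_functions_def G)
qed

lemma norm_diff_le_linear_growth:
  "norm (v - a) \<le> (1 + norm a) * (1 + norm v)"
proof -
  have "norm (v - a) \<le> norm v + norm a" by (rule norm_triangle_ineq4)
  also have "\<dots> \<le> (1 + norm a) * (1 + norm v)" by (simp add: algebra_simps)
  finally show ?thesis .
qed

text \<open>Integrating this function against \<open>\<rho> t\<close> gives the half second moment;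
  its constant Laplacian is the source of the term \<open>d * \<sigma>\<^sup>2\<close> in
  \<kappa>.\<close>

lemma quadratic_test_function:
  fixes vs :: "real^'n"
  defines "\<phi> \<equiv> \<lambda>v. (norm (v - vs))\<^sup>2 / 2"
  shows "\<phi> \<in> test_functions" "gradient \<phi> = (\<lambda>v. v - vs)"
    "laplacian \<phi> = (\<lambda>_. real CARD('n))"
proof -
  have d: "(\<phi> has_derivative (\<lambda>h. (v - vs) \<bullet> h)) (at v)" for v
    unfolding \<phi>_def power2_norm_eq_inner
    by (auto intro!: derivative_eq_intros simp: inner_commute)
  have d2: "((\<lambda>v. v - vs) has_derivative (\<lambda>h. mat 1 *v h)) (at v)" for v
    by (auto intro!: derivative_eq_intros)
  have tr: "trace (mat 1 :: real^'n^'n) = real CARD('n)" by (rule trace_I)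
  note b = norm_diff_le_linear_growth[of _ vs]
  have "1 + norm vs > 0" by (simp add: add_pos_nonneg)
  from test_functionsI[OF d d2 _ _ this b, of "real CARD('n)"]
  show "\<phi> \<in> test_functions" "gradient \<phi> = (\<lambda>v. v - vs)"
    "laplacian \<phi> = (\<lambda>_. real CARD('n))"
    by (auto simp: tr)
qed

text \<open>A truncated paraboloid, of which the cube is the test function: 3 is the least integer
  exponent that makes it twice continuously differentiable across the sphere of radius
  \<open>r\<close>, and its Laplacian still has one factor \<open>cutoff\<close>.\<close>

definition cutoff :: "real^'n \<Rightarrow> real \<Rightarrow> real^'n \<Rightarrow> real" where
  "cutoff vs r v = max 0 (1 - (norm (v - vs))\<^sup>2 / r\<^sup>2)"

text \<open>The critical point is x = 0, where the difference quotient is at most |h|^k in absolute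
  value and tends to 0 because k \<ge> 1.\<close>

lemma has_real_derivative_max_0_power:
  fixes x :: real
  assumes "k \<ge> 1"
  shows "((\<lambda>x. max 0 x ^ Suc k) has_real_derivative real (Suc k) * max 0 x ^ k) (at x)"
proof -
  consider "x > 0" | "x < 0" | "x = 0" by linarith
  then show ?thesis
  proof cases
    case 1
    have "((\<lambda>x. x ^ Suc k) has_real_derivative real (Suc k) * max 0 x ^ k) (at x)"
      using 1 by (auto intro!: derivative_eq_intros simp del: power_Suc)
    then show ?thesis
      by (rule DERIV_cong_ev[THEN iffD1, rotated -1])
        (use 1 in \<open>auto intro!: eventually_mono[OF eventually_nhds_in_open[of "{0<..}"]]\<close>)
  next
    case 2
    have "((\<lambda>x. 0) has_real_derivative real (Suc k) * max 0 x ^ k) (at x)"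
      using 2 assms by (auto simp: zero_power)
    then show ?thesis
      by (rule DERIV_cong_ev[THEN iffD1, rotated -1])
        (use 2 in \<open>auto intro!: eventually_mono[OF eventually_nhds_in_open[of "{..<0}"]]\<close>)
  next
    case 3
    have "((\<lambda>h::real. (max 0 h ^ Suc k) / h) \<longlongrightarrow> 0) (at 0)"
    proof (rule Lim_null_comparison)
      show "\<forall>\<^sub>F h in at 0. norm (max 0 h ^ Suc k / h) \<le> \<bar>h\<bar> ^ k"
        by (rule always_eventually) (auto simp: max_def)
      show "((\<lambda>h::real. \<bar>h\<bar> ^ k) \<longlongrightarrow> 0) (at 0)"
        using assms by (auto intro!: tendsto_eq_intros)
    qed
    then show ?thesis
      unfolding 3 DERIV_def using assms by (simp add: zero_power del: power_Suc)
  qed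
qed

lemma cutoff_power_has_derivative:
  assumes "k \<ge> 1"
  shows "((\<lambda>v. cutoff vs r v ^ Suc k) has_derivative
    (\<lambda>h. - (2 * real (Suc k) / r\<^sup>2) * cutoff vs r v ^ k * ((v - vs) \<bullet> h))) (at v)"
proof -
  have 1: "((\<lambda>v. 1 - (norm (v - vs))\<^sup>2 / r\<^sup>2) has_derivative (\<lambda>h. - 2 * ((v - vs) \<bullet> h) / r\<^sup>2)) (at v)"
    unfolding power2_norm_eq_inner divide_inverse
    by (auto intro!: derivative_eq_intros simp: inner_commute)
  show ?thesis
    unfolding cutoff_def
    by (rule has_derivative_eq_rhs[OF DERIV_compose_FDERIV[OF
          has_real_derivative_max_0_power[OF assms] 1]])
      (simp add: field_simps del: power_Suc)
qed

lemma continuous_cutoff: "continuous_on S (cutoff vs r)"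
  unfolding cutoff_def divide_inverse by (intro continuous_intros)

lemma cutoff_range: "0 \<le> cutoff vs r v" "cutoff vs r v \<le> 1"
  by (auto simp: cutoff_def)

lemma cutoff_pos_iff:
  assumes "r > 0"
  shows "0 < cutoff vs r v \<longleftrightarrow> norm (v - vs) < r"
proof -
  have "0 < cutoff vs r v \<longleftrightarrow> (norm (v - vs))\<^sup>2 < r\<^sup>2"
    using assms by (auto simp: cutoff_def less_max_iff_disj)
  also have "\<dots> \<longleftrightarrow> norm (v - vs) < r"
    using assms by (auto intro: power_strict_mono power2_less_imp_less)
  finally show ?thesis .
qed

lemma cutoff_test_function:
  fixes vs :: "real^'n" and r :: real
  defines "\<phi> \<equiv> \<lambda>v. cutoff vs r v ^ 3"
  assumes r: "r > 0"
  shows "\<phi> \<in> test_functions" "gradient \<phi> = (\<lambda>v. (- 6 / r\<^sup>2 * cutoff vs r v ^ 2) *\<^sub>R (v - vs))"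
    "laplacian \<phi> = (\<lambda>v. 6 / r\<^sup>2 * cutoff vs r v *
       (4 * ((norm (v - vs))\<^sup>2 / r\<^sup>2) - real CARD('n) * cutoff vs r v))"
proof -
  define u where "u = cutoff vs r"
  define b where "b = 4 / r\<^sup>2"
  define c where "c = 6 / r\<^sup>2"
  define G where "G = (\<lambda>v. (- c * u v ^ 2) *\<^sub>R (v - vs))"
  \<comment> \<open>With x = v - vs, the Hessian is \<open>- c\<close> times u^2 I - b u x x^T; the
    rank-one part comes from the gradient - b u x of u^2.\<close>
  define A :: "real^'n \<Rightarrow> real^'n^'n" where
    "A = (\<lambda>v. \<chi> i j. - c * ((if i = j then u v ^ 2 else 0)
          - b * u v * (v - vs) $ i * (v - vs) $ j))"
  define L where "L = (\<lambda>v. 6 / r\<^sup>2 * u v * (4 * ((norm (v - vs))\<^sup>2 / r\<^sup>2) - real CARD('n) * u v))"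
  note u_range = cutoff_range[of vs r, folded u_def]
  have d1: "(\<phi> has_derivative (\<lambda>h. G v \<bullet> h)) (at v)" for v
    using cutoff_power_has_derivative[of 2 vs r v]
    by (simp add: \<phi>_def G_def u_def c_def numeral_3_eq_3[symmetric])
  have du: "((\<lambda>v. u v ^ 2) has_derivative (\<lambda>h. - b * u v * ((v - vs) \<bullet> h))) (at v)" for v
    using cutoff_power_has_derivative[of 1 vs r v]
    by (simp add: u_def power2_eq_square b_def)
  have Av: "A v *v h = (- c) *\<^sub>R (u v ^ 2 *\<^sub>R h - (b * u v * ((v - vs) \<bullet> h)) *\<^sub>R (v - vs))"
    for v h
  proof -
    have "(\<Sum>j\<in>UNIV. A v $ i $ j * h $ j) =
      - c * (u v ^ 2 * h $ i - b * u v * ((v - vs) \<bullet> h) * (v - vs) $ i)" for i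
    proof -
      have "(\<Sum>j\<in>UNIV. A v $ i $ j * h $ j) =
        (\<Sum>j\<in>UNIV. (if i = j then - c * u v ^ 2 * h $ i else 0)
          + c * (b * u v) * (v - vs) $ i * ((v - vs) $ j * h $ j))"
        by (intro sum.cong) (auto simp: A_def algebra_simps)
      also have "\<dots> = - c * u v ^ 2 * h $ i
          + c * (b * u v) * (v - vs) $ i * ((v - vs) \<bullet> h)"
        by (simp add: sum.distrib inner_vec_def sum_distrib_left)
      finally show ?thesis by (simp add: algebra_simps)
    qed
    then show ?thesis
      by (simp add: vec_eq_iff matrix_vector_mult_def)
  qed
  have d2: "(G has_derivative (\<lambda>h. A v *v h)) (at v)" for v
    unfolding G_def Av
    by (rule derivative_eq_intros du | simp add: algebra_simps)+
  have cu: "continuous_on UNIV u" by (simp add: u_def continuous_cutoff)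
  have cif: "continuous_on UNIV (\<lambda>v. if i = j then u v ^ 2 else 0)" for i j :: 'n
    by (cases "i = j") (auto intro!: continuous_intros cu)
  have cA: "continuous_on UNIV A"
    unfolding A_def
    by (intro continuous_on_vec_lambda continuous_intros cu cif)
  have tr: "trace (A v) = L v" for v
  proof -
    have "trace (A v) = - c * (real CARD('n) * u v ^ 2
        - b * u v * ((v - vs) \<bullet> (v - vs)))"
      by (simp add: trace_def A_def inner_vec_def sum_subtractf sum_negf sum.distrib
          sum_distrib_left algebra_simps)
    then show ?thesis
      by (simp add: L_def b_def c_def power2_norm_eq_inner[symmetric] algebra_simps power2_eq_square)
  qed
  \<comment> \<open>The factor \<open>u v\<close> confines the Laplacian to the ball of radius
    \<open>r\<close>, where |v - vs|^2 / r^2 is below 1.\<close>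
  have bL: "\<bar>trace (A v)\<bar> \<le> 6 / r\<^sup>2 * (4 + real CARD('n))" for v
  proof (cases "u v = 0")
    case True
    then show ?thesis by (simp add: tr L_def)
  next
    case False
    then have "u v > 0" using u_range(1)[of v] by linarith
    then have "(norm (v - vs))\<^sup>2 / r\<^sup>2 < 1" by (auto simp: u_def cutoff_def less_max_iff_disj)
    moreover have "real CARD('n) * u v \<le> real CARD('n)"
      using u_range(2)[of v] by (simp add: mult_left_le)
    moreover have "(norm (v - vs))\<^sup>2 / r\<^sup>2 \<ge> 0" "real CARD('n) * u v \<ge> 0"
      using u_range(1)[of v] by auto
    ultimately have "\<bar>4 * ((norm (v - vs))\<^sup>2 / r\<^sup>2) - real CARD('n) * u v\<bar> \<le> 4 + real CARD('n)"
      by linarith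
    moreover have "u v \<le> 1" "0 \<le> u v" using u_range by auto
    ultimately have "u v * \<bar>4 * ((norm (v - vs))\<^sup>2 / r\<^sup>2) - real CARD('n) * u v\<bar>
        \<le> 1 * (4 + real CARD('n))"
      by (intro mult_mono) auto
    then have "6 / r\<^sup>2 * (u v * \<bar>4 * ((norm (v - vs))\<^sup>2 / r\<^sup>2) - real CARD('n) * u v\<bar>)
        \<le> 6 / r\<^sup>2 * (4 + real CARD('n))"
      by (intro mult_left_mono) auto
    then show ?thesis
      using \<open>0 \<le> u v\<close> by (simp add: tr L_def abs_mult mult.assoc)
  qed
  have bG: "norm (G v) \<le> 6 / r\<^sup>2 * (1 + norm vs) * (1 + norm v)" for v
  proof -
    have "(u v)\<^sup>2 \<le> 1" using u_range[of v] by (simp add: power_le_one)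
    then have "(u v)\<^sup>2 * norm (v - vs) \<le> 1 * ((1 + norm vs) * (1 + norm v))"
      by (intro mult_mono norm_diff_le_linear_growth) auto
    then have "c * ((u v)\<^sup>2 * norm (v - vs)) \<le> c * ((1 + norm vs) * (1 + norm v))"
      by (intro mult_left_mono) (auto simp: c_def)
    moreover have "norm (G v) = c * ((u v)\<^sup>2 * norm (v - vs))"
      by (simp add: G_def abs_mult c_def)
    ultimately show ?thesis by (simp only: c_def[symmetric] mult.assoc mult_1)
  qed
  have "6 / r\<^sup>2 * (1 + norm vs) > 0" using r by (simp add: add_pos_nonneg)
  from test_functionsI[OF d1 d2 cA bL this bG]
  show "\<phi> \<in> test_functions" "gradient \<phi> = (\<lambda>v. (- 6 / r\<^sup>2 * cutoff vs r v ^ 2) *\<^sub>R (v - vs))"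
    "laplacian \<phi> = (\<lambda>v. 6 / r\<^sup>2 * cutoff vs r v *
       (4 * ((norm (v - vs))\<^sup>2 / r\<^sup>2) - real CARD('n) * cutoff vs r v))"
    by (auto simp: tr G_def L_def u_def c_def)
qed

section \<open>Bootstrap in time\<close>

text \<open>Gronwall's inequality in product form: f t * exp (k t) has a nonnegative derivative.
  Differentiability is asked in the open interval, which is where a weak solution supplies
  it.\<close>

lemma exp_weighted_mono:
  fixes f :: "real \<Rightarrow> real"
  assumes "a \<le> b" "continuous_on {a..b} f"
    and "\<And>t. a < t \<Longrightarrow> t < b \<Longrightarrow> (f has_real_derivative f' t) (at t)"
    and "\<And>t. a < t \<Longrightarrow> t < b \<Longrightarrow> f' t \<ge> - k * f t"
  shows "f a * exp (k * a) \<le> f b * exp (k * b)"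
proof (rule DERIV_nonneg_imp_increasing_open[OF assms(1)])
  fix t assume t: "a < t" "t < b"
  have "((\<lambda>t. f t * exp (k * t)) has_real_derivative (f' t + k * f t) * exp (k * t)) (at t)"
    by (auto intro!: derivative_eq_intros assms(3) t simp: algebra_simps)
  moreover have "(f' t + k * f t) * exp (k * t) \<ge> 0"
    using assms(4)[OF t] by simp
  ultimately show "\<exists>y. ((\<lambda>t. f t * exp (k * t)) has_real_derivative y) (at t) \<and> 0 \<le> y"
    by blast
qed (intro continuous_intros assms(2))

text \<open>The upper bound \<open>V t < 2 * V 0\<close> enters the bootstrap hypothesis because the decay of \<open>V\<close> is
  only known as long as the differential inequalities hold.\<close>

lemma bootstrap_decay:
  fixes V g V' g' :: "real \<Rightarrow> real"
  assumes \<kappa>: "\<kappa> > 0" and \<theta>: "0 < \<theta>" "\<theta> < 1" and \<epsilon>: "0 < \<epsilon>" "\<epsilon> < V 0"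
    and T: "T = 1 / ((1 - \<theta>) * \<kappa>) * ln (V 0 / \<epsilon>)"
    and p: "p \<ge> 0" and m: "m < g 0 * exp (- p * T)" "g 0 > 0"
    and cg: "continuous_on {0..<T} g" and cV: "continuous_on {0..T} V"
    and dg: "\<And>t. 0 < t \<Longrightarrow> t < T \<Longrightarrow> (g has_real_derivative g' t) (at t)"
    and dV: "\<And>t. 0 < t \<Longrightarrow> t < T \<Longrightarrow> (V has_real_derivative V' t) (at t)"
    and boot: "\<And>t. 0 < t \<Longrightarrow> t < T \<Longrightarrow> m < g t \<Longrightarrow> \<epsilon> < V t \<Longrightarrow> V t < 2 * V 0 \<Longrightarrow>
      g' t \<ge> - p * g t \<and> V' t \<ge> - ((1 + \<theta>/2) * \<kappa>) * V t \<and> V' t \<le> - ((1 - \<theta>) * \<kappa>) * V t"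
  shows "\<exists>\<tau>\<in>{(1 - \<theta>) / (1 + \<theta>/2) * T..T}. V \<tau> = \<epsilon> \<and>
    (\<forall>t\<in>{0..\<tau>}. V t \<le> V 0 * exp (- (1 - \<theta>) * \<kappa> * t))"
proof -
  have lnp: "ln (V 0 / \<epsilon>) > 0" using \<epsilon> by simp
  then have T0: "T > 0" using \<kappa> \<theta> by (simp add: T)
  have Tl: "(1 - \<theta>) * \<kappa> * T = ln (V 0 / \<epsilon>)" using \<kappa> \<theta> by (simp add: T)
  define P where "P t \<longleftrightarrow> m < g t \<and> \<epsilon> < V t \<and> V t < 2 * V 0" for t
  \<comment> \<open>All three inequalities in \<open>P\<close> are strict, so by continuity
    \<open>P\<close> persists a little beyond any time before \<open>T\<close> at which it holds.
    Hence \<open>Sup S\<close> is the first failure of \<open>P\<close> or the end point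
    \<open>T\<close>.\<close>
  define S where "S = {t. 0 \<le> t \<and> t < T \<and> (\<forall>s\<in>{0..t}. P s)}"
  have m0: "m < g 0"
  proof -
    have "g 0 * exp (- p * T) \<le> g 0 * 1" using m(2) p T0 by (intro mult_left_mono) auto
    then show ?thesis using m(1) by simp
  qed
  have "0 \<in> S" using T0 m0 \<epsilon> by (auto simp: S_def P_def)
  have bdd: "bdd_above S" by (rule bdd_aboveI[of _ T]) (auto simp: S_def)
  define \<tau> where "\<tau> = Sup S"
  have \<tau>0: "0 \<le> \<tau>" unfolding \<tau>_def using \<open>0 \<in> S\<close> bdd by (rule cSup_upper)
  have \<tau>T: "\<tau> \<le> T" unfolding \<tau>_def using \<open>0 \<in> S\<close> by (intro cSup_least) (auto simp: S_def)
  have before: "P t" if "0 \<le> t" "t < \<tau>" for t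
  proof -
    obtain s where "s \<in> S" "t < s"
      using \<open>t < \<tau>\<close> \<open>0 \<in> S\<close> less_cSupD[of S t] by (auto simp: \<tau>_def)
    then show ?thesis using that by (auto simp: S_def)
  qed
  have ineqs: "g' t \<ge> - p * g t" "V' t \<ge> - ((1 + \<theta>/2) * \<kappa>) * V t" "V' t \<le> - ((1 - \<theta>) * \<kappa>) * V t"
    if "0 < t" "t < \<tau>" for t
    using before[of t] boot[of t] that \<tau>T by (auto simp: P_def)
  have g_low: "g 0 * exp (- p * t) \<le> g t" if "0 \<le> t" "t \<le> \<tau>" "t < T" for t
  proof -
    have "g 0 * exp (p * 0) \<le> g t * exp (p * t)"
      by (rule exp_weighted_mono[of 0 t g g'])
        (use that dg ineqs in \<open>auto intro: continuous_on_subset[OF cg]\<close>)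
    then show ?thesis by (simp add: exp_minus field_simps)
  qed
  have V_low: "V 0 * exp (- ((1 + \<theta>/2) * \<kappa>) * t) \<le> V t" if "0 \<le> t" "t \<le> \<tau>" for t
  proof -
    have "V 0 * exp ((1 + \<theta>/2) * \<kappa> * 0) \<le> V t * exp ((1 + \<theta>/2) * \<kappa> * t)"
      by (rule exp_weighted_mono[of 0 t V V'])
        (use that dV ineqs \<tau>T in \<open>auto intro: continuous_on_subset[OF cV]\<close>)
    then show ?thesis by (simp add: exp_minus field_simps)
  qed
  have V_up: "V t \<le> V 0 * exp (- (1 - \<theta>) * \<kappa> * t)" if "0 \<le> t" "t \<le> \<tau>" for t
  proof -
    have "(- V 0) * exp ((1 - \<theta>) * \<kappa> * 0) \<le> (- V t) * exp ((1 - \<theta>) * \<kappa> * t)"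
    proof (rule exp_weighted_mono[of 0 t "\<lambda>t. - V t" "\<lambda>t. - V' t"])
      show "continuous_on {0..t} (\<lambda>t. - V t)"
        using that \<tau>T by (intro continuous_intros continuous_on_subset[OF cV]) auto
      fix s assume s: "0 < s" "s < t"
      show "((\<lambda>t. - V t) has_real_derivative - V' s) (at s)"
        using s that \<tau>T by (intro DERIV_minus dV) auto
      show "- ((1 - \<theta>) * \<kappa>) * - V s \<le> - V' s"
        using ineqs(3)[of s] s that by simp
    qed (use that in auto)
    then have le: "V t * exp ((1 - \<theta>) * \<kappa> * t) \<le> V 0" by simp
    have "V t = V t * exp ((1 - \<theta>) * \<kappa> * t) * exp (- ((1 - \<theta>) * \<kappa> * t))"
      by (simp add: exp_minus)
    also have "\<dots> \<le> V 0 * exp (- ((1 - \<theta>) * \<kappa> * t))"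
      using le by (intro mult_right_mono) auto
    finally show ?thesis by (simp add: algebra_simps)
  qed
  \<comment> \<open>The strict inequality before \<tau> passes to the left limit as a weak one; at
    \<tau> = 0 there is no left limit, and the initial value decides.\<close>
  have "V \<tau> \<ge> \<epsilon>"
  proof (cases "\<tau> = 0")
    case True
    then show ?thesis using \<epsilon> by simp
  next
    case False
    show ?thesis
    proof (rule tendsto_lowerbound)
      show "(V \<longlongrightarrow> V \<tau>) (at \<tau> within {0..<\<tau>})"
        using cV \<tau>0 \<tau>T unfolding continuous_on_def
        by (auto intro: tendsto_within_subset[of _ _ _ "{0..T}"])
      show "\<forall>\<^sub>F t in at \<tau> within {0..<\<tau>}. \<epsilon> \<le> V t"
        using before by (auto simp: eventually_at_filter P_def intro!: always_eventually less_imp_le)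
      show "at \<tau> within {0..<\<tau>} \<noteq> bot"
        using False \<tau>0 by (simp add: at_within_eq_bot_iff)
    qed
  qed
  moreover have "V \<tau> \<le> \<epsilon>"
  proof (cases "\<tau> = T")
    case True
    \<comment> \<open>\<open>T\<close> is the time at which the upper exponential bound reaches
      \<epsilon>.\<close>
    have "- (1 - \<theta>) * \<kappa> * T = - ln (V 0 / \<epsilon>)"
      using Tl by (simp add: algebra_simps)
    then have "exp (- (1 - \<theta>) * \<kappa> * T) = \<epsilon> / V 0"
      using \<epsilon> by (simp add: exp_minus)
    then show ?thesis using V_up[OF \<tau>0] \<epsilon> True by simp
  next
    case False
    then have lt: "\<tau> < T" using \<tau>T by simp
    show ?thesis
    proof (rule ccontr)
      assume "\<not> V \<tau> \<le> \<epsilon>"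
      \<comment> \<open>If V \<tau> were above \<epsilon>, then \<open>P\<close> would hold at
        \<tau> itself: the integrated inequalities give V \<tau> \<le> V 0 < 2 V 0 and g \<tau>
        \<ge> g 0 exp (- p T) > m. By continuity \<open>P\<close> would extend beyond \<tau>,
        against the choice of the supremum.\<close>
      have "V \<tau> \<le> V 0 * 1"
      proof (rule order_trans[OF V_up[OF \<tau>0 order_refl]])
        have "(1 - \<theta>) * \<kappa> * \<tau> \<ge> 0" using \<theta> \<kappa> \<tau>0 by simp
        then show "V 0 * exp (- (1 - \<theta>) * \<kappa> * \<tau>) \<le> V 0 * 1"
          using \<epsilon> by (intro mult_left_mono) (auto simp: algebra_simps)
      qed
      moreover have "m < g \<tau>"
      proof -
        have "g 0 * exp (- p * T) \<le> g 0 * exp (- p * \<tau>)"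
          using m(2) p lt by (intro mult_left_mono) (auto intro: mult_left_mono)
        then show ?thesis using m(1) g_low[OF \<tau>0 order_refl lt] by simp
      qed
      ultimately have P\<tau>: "m < g \<tau>" "\<epsilon> < V \<tau>" "V \<tau> < 2 * V 0"
        using \<epsilon> \<open>\<not> V \<tau> \<le> \<epsilon>\<close> by auto
      have lg: "(g \<longlongrightarrow> g \<tau>) (at \<tau> within {0..<T})"
        using cg \<tau>0 lt by (auto simp: continuous_on_def)
      have lV: "(V \<longlongrightarrow> V \<tau>) (at \<tau> within {0..<T})"
        using cV \<tau>0 lt unfolding continuous_on_def
        by (auto intro: tendsto_within_subset[of _ _ _ "{0..T}"])
      have "\<forall>\<^sub>F t in at \<tau> within {0..<T}. P t"
        unfolding P_def
        using order_tendstoD(1)[OF lg P\<tau>(1)] order_tendstoD(1)[OF lV P\<tau>(2)]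
          order_tendstoD(2)[OF lV P\<tau>(3)]
        by eventually_elim auto
      then obtain d where d: "d > 0" "\<And>t. t \<in> {0..<T} \<Longrightarrow> t \<noteq> \<tau> \<Longrightarrow> dist t \<tau> < d \<Longrightarrow> P t"
        by (auto simp: eventually_at)
      define t where "t = \<tau> + min (d/2) ((T - \<tau>)/2)"
      have t: "\<tau> < t" "t < T" "t < \<tau> + d" using d(1) lt by (auto simp: t_def min_def field_simps)
      have "P s" if "s \<in> {0..t}" for s
      proof -
        consider "s < \<tau>" | "s = \<tau>" | "\<tau> < s" by linarith
        then show ?thesis
        proof cases
          case 2
          then show ?thesis using P\<tau> by (simp add: P_def)
        next
          case 3
          then show ?thesis using that t \<tau>0 by (intro d(2)) (auto simp: dist_real_def)
        qed (use before that in auto)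
      qed
      then have "t \<in> S" using t \<tau>0 by (auto simp: S_def)
      then have "t \<le> \<tau>" unfolding \<tau>_def using bdd by (rule cSup_upper)
      then show False using t by simp
    qed
  qed
  ultimately have V\<tau>: "V \<tau> = \<epsilon>" by simp
  \<comment> \<open>V falls at most at rate (1 + \<theta>/2) \<kappa>, so reaching \<epsilon> takes
    at least ln (V 0 / \<epsilon>) / ((1 + \<theta>/2) \<kappa>), which is the claimed fraction of
    \<open>T\<close>.\<close>
  have "V 0 * exp (- ((1 + \<theta>/2) * \<kappa>) * \<tau>) \<le> \<epsilon>"
    using V_low[OF \<tau>0 order_refl] V\<tau> by simp
  then have "V 0 / \<epsilon> \<le> exp ((1 + \<theta>/2) * \<kappa> * \<tau>)"
    using \<epsilon> by (simp add: exp_minus field_simps)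
  then have "ln (V 0 / \<epsilon>) \<le> (1 + \<theta>/2) * \<kappa> * \<tau>"
    using \<epsilon> by (metis divide_pos_pos ln_exp ln_mono less_trans)
  then have "(1 - \<theta>) * T * \<kappa> \<le> (1 + \<theta>/2) * \<tau> * \<kappa>"
    unfolding Tl[symmetric] by (simp add: algebra_simps)
  then have "(1 - \<theta>) * T \<le> (1 + \<theta>/2) * \<tau>" using \<kappa> by simp
  then have "(1 - \<theta>) / (1 + \<theta>/2) * T \<le> \<tau>" using \<theta> by (simp add: field_simps)
  then show ?thesis using \<tau>T V\<tau> V_up by auto
qed

section \<open>Generator estimate and Laplace principle\<close>

text \<open>Where \<open>u\<close> is small, the Laplacian of the bump is positive and absorbs the drift after completing
  the square; elsewhere \<open>u \<ge> 3 / (3 + d)\<close>, so that every bounded quantity is dominated by \<open>u\<^sup>2\<close>.\<close>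

lemma generator_cutoff_algebra:
  fixes a b u h W \<sigma> lam r B d :: real
  assumes r: "r > 0" and lam: "lam > 0" and \<sigma>: "\<sigma> > 0" and d: "d \<ge> 0" and B: "B \<ge> 0"
    and h: "0 \<le> h" "h \<le> 1" and u: "0 < u" "u = 1 - b\<^sup>2 / r\<^sup>2"
    and a: "0 \<le> a" "a \<le> r + B" and b: "0 \<le> b" "b \<le> r" and W: "\<bar>W\<bar> \<le> a * b"
  shows "lam * h * u * W + \<sigma>\<^sup>2 / 2 * a\<^sup>2 * (4 * (b\<^sup>2 / r\<^sup>2) - d * u)
    \<ge> - (lam\<^sup>2 * r\<^sup>2 / (2 * \<sigma>\<^sup>2) + (lam * (r + B) * r + \<sigma>\<^sup>2 / 2 * (r + B)\<^sup>2 * d) * (3 + d) / 3) * u\<^sup>2"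
proof -
  define K where "K = lam * (r + B) * r + \<sigma>\<^sup>2 / 2 * (r + B)\<^sup>2 * d"
  define s where "s = b\<^sup>2 / r\<^sup>2"
  have s0: "s \<ge> 0" by (simp add: s_def)
  have us: "u = 1 - s" using u(2) by (simp add: s_def)
  have K0: "K \<ge> 0" using r lam d B by (simp add: K_def)
  have q0: "lam\<^sup>2 * r\<^sup>2 / (2 * \<sigma>\<^sup>2) \<ge> 0" by simp
  have "h * \<bar>W\<bar> \<le> 1 * (a * b)" using h W by (intro mult_mono) auto
  then have "\<bar>h * W\<bar> \<le> a * b" using h(1) by (simp add: abs_mult)
  then have "- (a * b) \<le> h * W" by linarith
  then have "lam * u * (- (a * b)) \<le> lam * u * (h * W)"
    using lam u by (intro mult_left_mono) auto
  then have drift: "- (lam * u * (a * b)) \<le> lam * h * u * W" by (simp add: algebra_simps)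
  show ?thesis
  proof (cases "3 * s \<ge> d * u")
    case True
    \<comment> \<open>Three of the four copies of \<open>s\<close> pay for \<open>d * u\<close>; the
      fourth is kept to absorb the drift.\<close>
    have "\<sigma>\<^sup>2 / 2 * a\<^sup>2 * s \<le> \<sigma>\<^sup>2 / 2 * a\<^sup>2 * (4 * s - d * u)"
      using True by (intro mult_left_mono) auto
    moreover have "- (lam\<^sup>2 * r\<^sup>2 / (2 * \<sigma>\<^sup>2)) * u\<^sup>2 \<le> - (lam * u * (a * b)) + \<sigma>\<^sup>2 / 2 * a\<^sup>2 * s"
    proof -
      \<comment> \<open>The factors are weighted so that the mixed term is exactly the drift bound
        \<open>lam * u * (a * b)\<close> and the first square is the remaining diffusion.\<close>
      have "0 \<le> (\<sigma> * a * b / r - lam * r * u / \<sigma>)\<^sup>2 / 2" by simp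
      also have "\<dots> = \<sigma>\<^sup>2 / 2 * a\<^sup>2 * s - lam * u * (a * b) + lam\<^sup>2 * r\<^sup>2 / (2 * \<sigma>\<^sup>2) * u\<^sup>2"
        using r \<sigma> by (simp add: s_def power2_diff power_mult_distrib power_divide)
      finally show ?thesis by (simp add: algebra_simps)
    qed
    moreover have "- (lam\<^sup>2 * r\<^sup>2 / (2 * \<sigma>\<^sup>2) + K * (3 + d) / 3) * u\<^sup>2
        \<le> - (lam\<^sup>2 * r\<^sup>2 / (2 * \<sigma>\<^sup>2)) * u\<^sup>2"
      using K0 d by (intro mult_right_mono) auto
    ultimately show ?thesis using drift unfolding K_def[symmetric] s_def[symmetric] by linarith
  next
    case False
    \<comment> \<open>Multiplying this bound by u trades the first power of u, which the crude
      bounds on drift and diffusion contain, for u^2.\<close>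
    then have "1 \<le> (3 + d) / 3 * u" by (simp add: us algebra_simps)
    then have "u * 1 \<le> u * ((3 + d) / 3 * u)" using u by (intro mult_left_mono) auto
    then have uu: "u \<le> (3 + d) / 3 * u\<^sup>2" by (simp add: power2_eq_square algebra_simps)
    have "a * b \<le> (r + B) * r" using a b r B by (intro mult_mono) auto
    then have "lam * u * (a * b) \<le> lam * u * ((r + B) * r)"
      using lam u by (intro mult_left_mono) auto
    moreover have "\<sigma>\<^sup>2 / 2 * a\<^sup>2 * (d * u) \<le> \<sigma>\<^sup>2 / 2 * (r + B)\<^sup>2 * (d * u)"
      using a d u by (intro mult_right_mono mult_left_mono power_mono) auto
    moreover have "\<sigma>\<^sup>2 / 2 * a\<^sup>2 * (4 * s) \<ge> 0" using s0 by simp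
    moreover have "\<sigma>\<^sup>2 / 2 * a\<^sup>2 * (4 * s - d * u) = \<sigma>\<^sup>2 / 2 * a\<^sup>2 * (4 * s) - \<sigma>\<^sup>2 / 2 * a\<^sup>2 * (d * u)"
      by (rule right_diff_distrib)
    moreover have "K * u = lam * u * ((r + B) * r) + \<sigma>\<^sup>2 / 2 * (r + B)\<^sup>2 * (d * u)"
      by (simp add: K_def algebra_simps)
    ultimately have "- (K * u) \<le> lam * h * u * W + \<sigma>\<^sup>2 / 2 * a\<^sup>2 * (4 * s - d * u)"
      using drift by linarith
    moreover have "K * u \<le> K * ((3 + d) / 3 * u\<^sup>2)" using uu K0 by (rule mult_left_mono)
    moreover have "0 \<le> lam\<^sup>2 * r\<^sup>2 / (2 * \<sigma>\<^sup>2) * u\<^sup>2" by simp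
    moreover have "- (lam\<^sup>2 * r\<^sup>2 / (2 * \<sigma>\<^sup>2) + K * (3 + d) / 3) * u\<^sup>2
        = - (lam\<^sup>2 * r\<^sup>2 / (2 * \<sigma>\<^sup>2) * u\<^sup>2) - K * ((3 + d) / 3 * u\<^sup>2)"
      by (simp only: minus_mult_left distrib_right minus_add_distrib) simp
    ultimately show ?thesis unfolding K_def[symmetric] s_def[symmetric] by linarith
  qed
qed

text \<open>The quantifier order is what matters: p is fixed before e, h and v, and e enters through
  its bound B alone. One p therefore serves all \<alpha>, all times and all solutions. The number h
  stands for a single value of H.\<close>

lemma generator_cutoff_ge:
  fixes vs e :: "real^'n" and lam \<sigma> r B :: real
  assumes r: "r > 0" and lam: "lam > 0" and \<sigma>: "\<sigma> > 0" and B: "B \<ge> 0"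
  shows "\<exists>p\<ge>0. \<forall>e h v. norm (e - vs) \<le> B \<longrightarrow> 0 \<le> h \<longrightarrow> h \<le> 1 \<longrightarrow>
    - lam * (h * ((v - e) \<bullet> gradient (\<lambda>v. cutoff vs r v ^ 3) v))
    + \<sigma>\<^sup>2 / 2 * ((norm (v - e))\<^sup>2 * laplacian (\<lambda>v. cutoff vs r v ^ 3) v)
    \<ge> - p * cutoff vs r v ^ 3"
proof -
  let ?d = "real CARD('n)"
  define q where "q = lam\<^sup>2 * r\<^sup>2 / (2 * \<sigma>\<^sup>2)
    + (lam * (r + B) * r + \<sigma>\<^sup>2 / 2 * (r + B)\<^sup>2 * ?d) * (3 + ?d) / 3"
  have q0: "q \<ge> 0" using lam r B by (simp add: q_def)
  have "- lam * (h * ((v - e) \<bullet> gradient (\<lambda>v. cutoff vs r v ^ 3) v))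
    + \<sigma>\<^sup>2 / 2 * ((norm (v - e))\<^sup>2 * laplacian (\<lambda>v. cutoff vs r v ^ 3) v)
    \<ge> - (6 / r\<^sup>2 * q) * cutoff vs r v ^ 3"
    if e: "norm (e - vs) \<le> B" and h: "0 \<le> h" "h \<le> 1" for e v :: "real^'n" and h
  proof -
    define u where "u = cutoff vs r v"
    define a where "a = norm (v - e)"
    define b where "b = norm (v - vs)"
    define W where "W = (v - e) \<bullet> (v - vs)"
    \<comment> \<open>After splitting off 6 / r^2 * u, the factor of
      \<open>generator_cutoff_algebra\<close> remains, and its bound in u^2 becomes one in
      u^3.\<close>
    have eq: "- lam * (h * ((v - e) \<bullet> gradient (\<lambda>v. cutoff vs r v ^ 3) v))
      + \<sigma>\<^sup>2 / 2 * ((norm (v - e))\<^sup>2 * laplacian (\<lambda>v. cutoff vs r v ^ 3) v)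
      = 6 / r\<^sup>2 * u * (lam * h * u * W + \<sigma>\<^sup>2 / 2 * a\<^sup>2 * (4 * (b\<^sup>2 / r\<^sup>2) - ?d * u))"
      unfolding cutoff_test_function[OF r] u_def[symmetric] a_def[symmetric] b_def[symmetric]
        inner_scaleR_right W_def[symmetric]
      by (simp add: algebra_simps power2_eq_square add_divide_distrib diff_divide_distrib)
    show ?thesis
    proof (cases "u = 0")
      case True
      then show ?thesis unfolding eq by (simp add: u_def)
    next
      case False
      then have u0: "u > 0" using cutoff_range(1)[of vs r v] by (simp add: u_def)
      then have b: "b < r" using cutoff_pos_iff[OF r, of vs v] by (simp add: u_def b_def)
      have ub: "u = 1 - b\<^sup>2 / r\<^sup>2" using u0 by (auto simp: u_def b_def cutoff_def max_def split: if_splits)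
      have "a \<le> b + norm (e - vs)" unfolding a_def b_def
        using norm_triangle_ineq4[of "v - vs" "e - vs"] by simp
      then have a: "a \<le> r + B" using b e by simp
      have "\<bar>W\<bar> \<le> a * b" unfolding W_def a_def b_def by (rule Cauchy_Schwarz_ineq2)
      then have "lam * h * u * W + \<sigma>\<^sup>2 / 2 * a\<^sup>2 * (4 * (b\<^sup>2 / r\<^sup>2) - ?d * u) \<ge> - q * u\<^sup>2"
        unfolding q_def using h ub u0 a b
        by (intro generator_cutoff_algebra r lam \<sigma> B) (auto simp: a_def b_def)
      then have "6 / r\<^sup>2 * u * (- q * u\<^sup>2) \<le> 6 / r\<^sup>2 * u *
          (lam * h * u * W + \<sigma>\<^sup>2 / 2 * a\<^sup>2 * (4 * (b\<^sup>2 / r\<^sup>2) - ?d * u))"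
        using u0 by (intro mult_left_mono) auto
      then show ?thesis unfolding eq u_def[symmetric]
        by (simp add: power3_eq_cube power2_eq_square mult_ac)
    qed
  qed
  then show ?thesis using q0 by (intro exI[of _ "6 / r\<^sup>2 * q"]) auto
qed

section \<open>Integrability under a finite fourth moment, and the Laplace principle\<close>

lemma integrable_bounded_times_quadratic:
  fixes \<mu> :: "('a::euclidean_space) measure" and f :: "'a \<Rightarrow> real"
  assumes \<mu>: "\<mu> \<in> prob_measures_p 4" and f: "f \<in> borel_measurable \<mu>" "\<And>v. \<bar>f v\<bar> \<le> K"
  shows "integrable \<mu> (\<lambda>v. (norm (v - a))\<^sup>2 * f v)"
proof (rule Bochner_Integration.integrable_bound)
  show "integrable \<mu> (\<lambda>v. K * (norm (v - a))\<^sup>2)"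
    using integrable_norm_diff_power2[OF \<mu>] by auto
  have "(\<lambda>v. (norm (v - a))\<^sup>2) \<in> borel_measurable \<mu>"
    using integrable_norm_diff_power2[OF \<mu>] by auto
  then show "(\<lambda>v. (norm (v - a))\<^sup>2 * f v) \<in> borel_measurable \<mu>" using f(1) by auto
  show "AE v in \<mu>. norm ((norm (v - a))\<^sup>2 * f v) \<le> norm (K * (norm (v - a))\<^sup>2)"
  proof (rule AE_I2)
    fix v
    have "(norm (v - a))\<^sup>2 * \<bar>f v\<bar> \<le> (norm (v - a))\<^sup>2 * K"
      using f(2) by (intro mult_left_mono) auto
    moreover have "K \<ge> 0" using f(2)[of v] abs_ge_zero[of "f v"] by linarith
    ultimately show "norm ((norm (v - a))\<^sup>2 * f v) \<le> norm (K * (norm (v - a))\<^sup>2)"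
      by (simp add: abs_mult mult.commute)
  qed
qed

lemma integrable_norm_diff:
  fixes \<mu> :: "('a::euclidean_space) measure"
  assumes "\<mu> \<in> prob_measures_p 4"
  shows "integrable \<mu> (\<lambda>v. norm (v - a))" "integrable \<mu> (\<lambda>v. v - a)"
proof -
  note * = prob_measures_p_D[OF assms]
  interpret prob_space \<mu> by fact
  have i: "integrable \<mu> (\<lambda>v. 1 + (norm (v - a))\<^sup>2)"
    using integrable_norm_diff_power2[OF assms] by auto
  have b: "AE v in \<mu>. norm (v - a) \<le> norm (1 + (norm (v - a))\<^sup>2)"
  proof (rule AE_I2)
    fix v
    show "norm (v - a) \<le> norm (1 + (norm (v - a))\<^sup>2)"
      using self_le_one_plus_power2[of "norm (v - a)"] by simp
  qed
  have m: "(\<lambda>v. v - a) \<in> borel_measurable \<mu>"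
    by (rule continuous_imp_measurable_sets_borel[OF *(2)]) (intro continuous_intros)
  show "integrable \<mu> (\<lambda>v. v - a)" using i m b by (rule Bochner_Integration.integrable_bound)
  then show "integrable \<mu> (\<lambda>v. norm (v - a))" by (rule integrable_norm)
qed

lemma integral_norm_diff_le:
  fixes \<mu> :: "('a::euclidean_space) measure"
  assumes "\<mu> \<in> prob_measures_p 4"
  shows "(\<integral>v. norm (v - a) \<partial>\<mu>) \<le> 1 + 2 * half_second_moment a \<mu>"
proof -
  note * = prob_measures_p_D[OF assms]
  interpret prob_space \<mu> by fact
  have "(\<integral>v. norm (v - a) \<partial>\<mu>) \<le> (\<integral>v. 1 + (norm (v - a))\<^sup>2 \<partial>\<mu>)"
    using integrable_norm_diff(1)[OF assms, of a] integrable_norm_diff_power2[OF assms, of a]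
    by (intro integral_mono) (auto intro: self_le_one_plus_power2)
  also have "\<dots> = 1 + 2 * half_second_moment a \<mu>"
    using integrable_norm_diff_power2[OF assms, of a]
    by (simp add: half_second_moment_def prob_space)
  finally show ?thesis .
qed

lemma integrable_cutoff:
  fixes \<mu> :: "(real^'n) measure"
  assumes "\<mu> \<in> prob_measures_p 4"
  shows "integrable \<mu> (\<lambda>v. cutoff vs r v ^ k)"
proof -
  note * = prob_measures_p_D[OF assms]
  interpret prob_space \<mu> by fact
  show ?thesis
  proof (rule integrable_const_bound[of _ 1])
    show "(\<lambda>v. cutoff vs r v ^ k) \<in> borel_measurable \<mu>"
      by (rule continuous_imp_measurable_sets_borel[OF *(2)])
        (intro continuous_intros continuous_cutoff)
  qed (auto intro!: AE_I2 power_le_one simp: abs_of_nonneg cutoff_range)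
qed

text \<open>A quantitative Laplace principle: the sublevel set \<open>{E - E vs \<le> 2 q}\<close> contributes at most \<open>\<zeta>\<close>
  to the deviation, and outside of it the weights are smaller than those on the ball of radius \<open>r\<close>
  by a factor \<open>exp (- \<alpha> q)\<close>.\<close>

lemma consensus_point_deviation:
  fixes E :: "real^'n \<Rightarrow> real"
  assumes \<mu>: "\<mu> \<in> prob_measures_p 4" and cE: "continuous_on UNIV E"
    and min: "\<And>v. E vs \<le> E v" and \<alpha>: "\<alpha> > 0" and r: "r > 0" and \<zeta>: "\<zeta> \<ge> 0"
    and sep: "\<And>v. E v \<le> E vs + 2 * q \<Longrightarrow> norm (v - vs) \<le> \<zeta>"
    and loc: "\<And>v. norm (v - vs) < r \<Longrightarrow> E v \<le> E vs + q"
    and m: "m > 0" "m \<le> (\<integral>v. cutoff vs r v ^ 3 \<partial>\<mu>)"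
  shows "norm (consensus_point E \<alpha> \<mu> - vs) \<le>
    \<zeta> + exp (- \<alpha> * q) * (1 + 2 * half_second_moment vs \<mu>) / m"
proof -
  note * = prob_measures_p_D[OF \<mu>]
  interpret prob_space \<mu> by fact
  define \<omega> where "\<omega> v = gibbs_weight E \<alpha> v" for v
  define \<omega>0 where "\<omega>0 = exp (- \<alpha> * E vs)"
  have \<omega>: "0 < \<omega> v" "\<omega> v \<le> \<omega>0" for v
    using min[of v] \<alpha> by (auto simp: \<omega>_def \<omega>0_def gibbs_weight_def)
  have \<omega>0: "\<omega>0 > 0" by (simp add: \<omega>0_def)
  have m\<omega>: "\<omega> \<in> borel_measurable \<mu>"
    unfolding \<omega>_def gibbs_weight_def
    by (rule continuous_imp_measurable_sets_borel[OF *(2)]) (intro continuous_intros cE)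
  have i\<omega>: "integrable \<mu> \<omega>"
    by (rule integrable_const_bound[of _ \<omega>0]) (use \<omega> m\<omega> in \<open>auto intro!: AE_I2 simp: less_imp_le\<close>)
  have i\<omega>x: "integrable \<mu> (\<lambda>v. \<omega> v *\<^sub>R (v - vs))"
  proof (rule Bochner_Integration.integrable_bound)
    show "integrable \<mu> (\<lambda>v. \<omega>0 * norm (v - vs))" using integrable_norm_diff(1)[OF \<mu>] by auto
    have "(\<lambda>v. v - vs) \<in> borel_measurable \<mu>" using integrable_norm_diff(2)[OF \<mu>, of vs] by auto
    then show "(\<lambda>v. \<omega> v *\<^sub>R (v - vs)) \<in> borel_measurable \<mu>" using m\<omega> by auto
    show "AE v in \<mu>. norm (\<omega> v *\<^sub>R (v - vs)) \<le> norm (\<omega>0 * norm (v - vs))"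
      using \<omega> \<omega>0 by (auto intro!: AE_I2 mult_right_mono simp: abs_of_pos)
  qed
  define Z where "Z = (\<integral>v. \<omega> v \<partial>\<mu>)"
  \<comment> \<open>The cubed bump lies below the indicator of the ball of radius \<open>r\<close>,
    and on that ball \<open>loc\<close> bounds the weight from below; thus the bump mass controls
    the normalising constant.\<close>
  have Zlow: "\<omega>0 * exp (- \<alpha> * q) * m \<le> Z"
  proof -
    have "\<omega>0 * exp (- \<alpha> * q) * m \<le> \<omega>0 * exp (- \<alpha> * q) * (\<integral>v. cutoff vs r v ^ 3 \<partial>\<mu>)"
      using m \<omega>0 by (intro mult_left_mono) auto
    also have "\<dots> = (\<integral>v. \<omega>0 * exp (- \<alpha> * q) * cutoff vs r v ^ 3 \<partial>\<mu>)" by simp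
    also have "\<dots> \<le> Z" unfolding Z_def
    proof (rule integral_mono)
      show "integrable \<mu> (\<lambda>v. \<omega>0 * exp (- \<alpha> * q) * cutoff vs r v ^ 3)"
        using integrable_cutoff[OF \<mu>] by auto
      fix v
      show "\<omega>0 * exp (- \<alpha> * q) * cutoff vs r v ^ 3 \<le> \<omega> v"
      proof (cases "norm (v - vs) < r")
        case True
        have "\<omega>0 * exp (- \<alpha> * q) * cutoff vs r v ^ 3 \<le> \<omega>0 * exp (- \<alpha> * q) * 1"
          using cutoff_range \<omega>0 by (intro mult_left_mono power_le_one) auto
        also have "\<dots> = exp (- \<alpha> * (E vs + q))"
          by (simp add: \<omega>0_def algebra_simps flip: exp_add)
        also have "\<dots> \<le> \<omega> v" using loc[OF True] \<alpha> by (simp add: \<omega>_def gibbs_weight_def)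
        finally show ?thesis .
      next
        case False
        then have "cutoff vs r v = 0"
          using cutoff_pos_iff[OF r, of vs v] cutoff_range(1)[of vs r v] by linarith
        then show ?thesis using \<omega>(1)[of v] by simp
      qed
    qed (rule i\<omega>)
    finally show ?thesis .
  qed
  moreover have "\<omega>0 * exp (- \<alpha> * q) * m > 0" using \<omega>0 m by simp
  ultimately have Z: "Z > 0" by linarith
  let ?M = "1 + 2 * half_second_moment vs \<mu>"
  have M: "(\<integral>v. norm (v - vs) \<partial>\<mu>) \<le> ?M" by (rule integral_norm_diff_le[OF \<mu>])
  have num: "norm (\<integral>v. \<omega> v *\<^sub>R (v - vs) \<partial>\<mu>) \<le> \<zeta> * Z + \<omega>0 * exp (- \<alpha> * (2 * q)) * ?M"
  proof -
    have "norm (\<integral>v. \<omega> v *\<^sub>R (v - vs) \<partial>\<mu>) \<le> (\<integral>v. norm (\<omega> v *\<^sub>R (v - vs)) \<partial>\<mu>)"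
      by (rule integral_norm_bound)
    also have "\<dots> \<le> (\<integral>v. \<zeta> * \<omega> v + \<omega>0 * exp (- \<alpha> * (2 * q)) * norm (v - vs) \<partial>\<mu>)"
    proof (rule integral_mono)
      fix v
      show "norm (\<omega> v *\<^sub>R (v - vs)) \<le> \<zeta> * \<omega> v + \<omega>0 * exp (- \<alpha> * (2 * q)) * norm (v - vs)"
      proof (cases "E v \<le> E vs + 2 * q")
        case True
        then have "\<omega> v * norm (v - vs) \<le> \<omega> v * \<zeta>"
          using sep \<omega>(1) by (intro mult_left_mono) (auto simp: less_imp_le)
        moreover have "\<omega>0 * exp (- \<alpha> * (2 * q)) * norm (v - vs) \<ge> 0" using \<omega>0 by simp
        ultimately have "\<omega> v * norm (v - vs)
            \<le> \<zeta> * \<omega> v + \<omega>0 * exp (- \<alpha> * (2 * q)) * norm (v - vs)"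
          by (simp only: mult.commute[of \<zeta>])
        then show ?thesis using \<omega>(1)[of v] by simp
      next
        case False
        then have "\<omega> v \<le> exp (- \<alpha> * (E vs + 2 * q))"
          using \<alpha> by (simp add: \<omega>_def gibbs_weight_def)
        also have "\<dots> = \<omega>0 * exp (- \<alpha> * (2 * q))"
          by (simp add: \<omega>0_def algebra_simps flip: exp_add)
        finally have "\<omega> v * norm (v - vs) \<le> \<omega>0 * exp (- \<alpha> * (2 * q)) * norm (v - vs)"
          by (intro mult_right_mono) auto
        moreover have "\<zeta> * \<omega> v \<ge> 0" using \<zeta> \<omega>(1)[of v] by simp
        ultimately show ?thesis using \<omega>(1)[of v] by simp
      qed
    qed (use i\<omega> integrable_norm[OF i\<omega>x] integrable_norm_diff(1)[OF \<mu>] in auto)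
    also have "\<dots> = \<zeta> * Z + \<omega>0 * exp (- \<alpha> * (2 * q)) * (\<integral>v. norm (v - vs) \<partial>\<mu>)"
      using i\<omega> integrable_norm_diff(1)[OF \<mu>] by (simp add: Z_def)
    also have "\<dots> \<le> \<zeta> * Z + \<omega>0 * exp (- \<alpha> * (2 * q)) * ?M"
      using M \<omega>0 by (intro add_left_mono mult_left_mono) auto
    finally show ?thesis .
  qed
  \<comment> \<open>The normalised weights have integral 1, so subtracting vs from the consensus
    point amounts to subtracting it inside the integral.\<close>
  have "consensus_point E \<alpha> \<mu> = (\<integral>v. (1 / Z) *\<^sub>R (\<omega> v *\<^sub>R (v - vs)) + (\<omega> v / Z) *\<^sub>R vs \<partial>\<mu>)"
    unfolding consensus_point_def \<omega>_def[symmetric] Z_def[symmetric]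
    by (intro Bochner_Integration.integral_cong) (auto simp: algebra_simps)
  also have "\<dots> = (\<integral>v. (1 / Z) *\<^sub>R (\<omega> v *\<^sub>R (v - vs)) \<partial>\<mu>) + (\<integral>v. (\<omega> v / Z) *\<^sub>R vs \<partial>\<mu>)"
    by (intro Bochner_Integration.integral_add integrable_scaleR_right integrable_scaleR_left
        integrable_divide i\<omega> i\<omega>x)
  also have "(\<integral>v. (\<omega> v / Z) *\<^sub>R vs \<partial>\<mu>) = (Z / Z) *\<^sub>R vs"
    by (subst integral_scaleR_left) (simp_all add: i\<omega> Z_def[symmetric])
  also have "(\<integral>v. (1 / Z) *\<^sub>R (\<omega> v *\<^sub>R (v - vs)) \<partial>\<mu>) = (1 / Z) *\<^sub>R (\<integral>v. \<omega> v *\<^sub>R (v - vs) \<partial>\<mu>)"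
    by (rule integral_scaleR_right)
  finally have "consensus_point E \<alpha> \<mu> - vs = (1 / Z) *\<^sub>R (\<integral>v. \<omega> v *\<^sub>R (v - vs) \<partial>\<mu>)"
    using Z by simp
  then have "norm (consensus_point E \<alpha> \<mu> - vs) = norm (\<integral>v. \<omega> v *\<^sub>R (v - vs) \<partial>\<mu>) / Z"
    using Z by simp
  also have "\<dots> \<le> (\<zeta> * Z + \<omega>0 * exp (- \<alpha> * (2 * q)) * ?M) / Z"
    using num Z by (intro divide_right_mono) auto
  also have "\<dots> = \<zeta> + \<omega>0 * exp (- \<alpha> * (2 * q)) * ?M / Z" using Z by (simp add: field_simps)
  also have "\<dots> \<le> \<zeta> + \<omega>0 * exp (- \<alpha> * (2 * q)) * ?M / (\<omega>0 * exp (- \<alpha> * q) * m)"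
    using Zlow \<omega>0 m Z half_second_moment_nonneg[of vs \<mu>]
    by (intro add_left_mono divide_left_mono) auto
  also have "\<omega>0 * exp (- \<alpha> * (2 * q)) * ?M / (\<omega>0 * exp (- \<alpha> * q) * m) = exp (- \<alpha> * q) * ?M / m"
  proof -
    have "exp (- \<alpha> * (2 * q)) = exp (- \<alpha> * q) * exp (- \<alpha> * q)"
      by (simp add: algebra_simps flip: exp_add)
    then show ?thesis using \<omega>0 by simp
  qed
  finally show ?thesis .
qed

section \<open>Decay of the second moment\<close>

lemma cond_A1_minimizer:
  assumes "cond_A1 E vs"
  shows "E vs \<le> E v" "(INF u. E u) = E vs"
  using assms cINF_lower[of E UNIV v] by (auto simp: cond_A1_def)

text \<open>Taking q \<le> \<open>Einf\<close> forces the point into the ball of radius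
  \<open>R0\<close>, and (\<zeta> \<eta>) powr (1 / \<nu>) is the excess at which the bound valid
  there equals \<zeta>.\<close>

lemma cond_A2_sublevel:
  assumes A1: "cond_A1 E vs" and A2: "cond_A2 E vs" and \<zeta>: "\<zeta> > 0"
  shows "\<exists>q>0. \<forall>v. E v \<le> E vs + q \<longrightarrow> norm (v - vs) \<le> \<zeta>"
proof -
  note min = cond_A1_minimizer[OF A1]
  obtain Einf \<eta> \<nu> :: real and R0 :: ereal where
    p: "Einf > 0" "\<eta> > 0" "\<nu> > 0"
    and near: "\<And>v. ereal (norm (v - vs)) \<le> R0 \<Longrightarrow> norm (v - vs) \<le> (E v - E vs) powr \<nu> / \<eta>"
    and far: "\<And>v. \<not> ereal (norm (v - vs)) \<le> R0 \<Longrightarrow> E v - E vs > Einf"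
    using A2 unfolding cond_A2_def min(2) by blast
  define q where "q = min Einf ((\<zeta> * \<eta>) powr (1 / \<nu>))"
  have "q > 0" using p \<zeta> by (simp add: q_def)
  moreover have "norm (v - vs) \<le> \<zeta>" if v: "E v \<le> E vs + q" for v
  proof -
    have "ereal (norm (v - vs)) \<le> R0" using far[of v] v by (force simp: q_def)
    then have "norm (v - vs) \<le> (E v - E vs) powr \<nu> / \<eta>" by (rule near)
    also have "\<dots> \<le> ((\<zeta> * \<eta>) powr (1 / \<nu>)) powr \<nu> / \<eta>"
      using p v min(1)[of v] by (intro divide_right_mono powr_mono2) (auto simp: q_def)
    also have "\<dots> = \<zeta>" using p \<zeta> by (simp add: powr_powr)
    finally show ?thesis .
  qed
  ultimately show ?thesis by blast
qed

text \<open>This is how the support condition enters: it makes the initial bump mass positive for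
  whatever \<open>r\<close> the Laplace principle dictates.\<close>

lemma integral_cutoff_pos:
  fixes vs :: "real^'n"
  assumes \<mu>: "\<mu> \<in> prob_measures_p 4" and supp: "vs \<in> measure_support \<mu>" and r: "r > 0"
  shows "(\<integral>v. cutoff vs r v ^ 3 \<partial>\<mu>) > 0"
proof (rule ccontr)
  note * = prob_measures_p_D[OF \<mu>]
  assume "\<not> ?thesis"
  moreover have "(\<integral>v. cutoff vs r v ^ 3 \<partial>\<mu>) \<ge> 0" by (simp add: cutoff_range)
  ultimately have "(\<integral>v. cutoff vs r v ^ 3 \<partial>\<mu>) = 0" by simp
  then have "AE v in \<mu>. cutoff vs r v ^ 3 = 0"
    using integral_nonneg_eq_0_iff_AE[OF integrable_cutoff[OF \<mu>, of vs r 3]]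
    by (simp add: cutoff_range)
  then have ae: "AE v in \<mu>. v \<notin> ball vs r"
  proof eventually_elim
    case (elim v)
    then show ?case using cutoff_pos_iff[OF r, of vs v] by (simp add: dist_norm norm_minus_commute)
  qed
  have "{v \<in> space \<mu>. \<not> v \<notin> ball vs r} = ball vs r" using *(3) by auto
  then have "emeasure \<mu> (ball vs r) = 0"
    using AE_iff_measurable[of "ball vs r" \<mu> "\<lambda>v. v \<notin> ball vs r"] ae *(2)
    by (metis borel_open open_ball)
  then show False using supp r by (auto simp: measure_support_def)
qed

text \<open>For \<open>H = 1\<close> and \<open>e = vs\<close> the second moment decays exactly at rate \<open>2 * lam - d * \<sigma>\<^sup>2\<close>. The defect
  of \<open>H\<close> is supported where \<open>E v < E e\<close>, hence, by the sublevel estimate, close to \<open>vs\<close>.\<close>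

lemma second_moment_drift_error:
  fixes vs e :: "real^'n" and h :: "real^'n \<Rightarrow> real"
  assumes \<mu>: "\<mu> \<in> prob_measures_p 4" and lam: "lam > 0"
    and h: "\<And>v. 0 \<le> h v" "\<And>v. h v \<le> 1" and near: "\<And>v. h v \<noteq> 1 \<Longrightarrow> norm (v - vs) \<le> \<zeta>"
    and int: "integrable \<mu> (\<lambda>v. h v * ((v - e) \<bullet> (v - vs)))"
    and e: "norm (e - vs) \<le> \<delta>" and \<zeta>: "\<zeta> \<ge> 0" and d: "d \<ge> 0"
  shows "\<bar>- lam * (\<integral>v. h v * ((v - e) \<bullet> (v - vs)) \<partial>\<mu>) + \<sigma>\<^sup>2 / 2 * (\<integral>v. (norm (v - e))\<^sup>2 * d \<partial>\<mu>)
      + (2 * lam - d * \<sigma>\<^sup>2) * half_second_moment vs \<mu>\<bar>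
    \<le> lam * ((\<zeta> + \<delta>) * \<zeta>) + (lam + d * \<sigma>\<^sup>2) * \<delta> * (1 + 2 * half_second_moment vs \<mu>)
      + d * \<sigma>\<^sup>2 / 2 * \<delta>\<^sup>2"
proof -
  note * = prob_measures_p_D[OF \<mu>]
  interpret prob_space \<mu> by fact
  have \<delta>: "\<delta> \<ge> 0" using e norm_ge_zero order_trans by blast
  let ?F = "\<lambda>v. - lam * (h v * ((v - e) \<bullet> (v - vs))) + \<sigma>\<^sup>2 / 2 * ((norm (v - e))\<^sup>2 * d)
      + (2 * lam - d * \<sigma>\<^sup>2) / 2 * (norm (v - vs))\<^sup>2"
  note i2 = integrable_norm_diff_power2[OF \<mu>]
  have iF: "integrable \<mu> ?F"
    using int i2 by (intro Bochner_Integration.integrable_add integrable_mult_right integrable_mult_left)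
  have pt: "\<bar>?F v\<bar> \<le> lam * ((\<zeta> + \<delta>) * \<zeta>) + d * \<sigma>\<^sup>2 / 2 * \<delta>\<^sup>2
      + (lam + d * \<sigma>\<^sup>2) * \<delta> * norm (v - vs)" for v
  proof -
    define x where "x = v - vs"
    define a where "a = e - vs"
    have ve: "v - e = x - a" by (simp add: x_def a_def)
    \<comment> \<open>The terms quadratic in x cancel apart from the defect 1 - h; what is left is
      small with \<zeta> or with a.\<close>
    have "?F v = lam * ((1 - h v) * ((x - a) \<bullet> x)) + (lam - d * \<sigma>\<^sup>2) * (a \<bullet> x)
        + d * \<sigma>\<^sup>2 / 2 * (norm a)\<^sup>2"
      unfolding ve x_def[symmetric] power2_norm_eq_inner
      by (simp add: inner_diff_left inner_diff_right inner_commute algebra_simps)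
        (simp add: field_simps)
    moreover have "\<bar>(1 - h v) * ((x - a) \<bullet> x)\<bar> \<le> (\<zeta> + \<delta>) * \<zeta>"
    proof (cases "h v = 1")
      case True
      then show ?thesis using \<zeta> \<delta> by simp
    next
      case False
      then have x: "norm x \<le> \<zeta>" using near by (simp add: x_def)
      have "\<bar>(x - a) \<bullet> x\<bar> \<le> norm (x - a) * norm x" by (rule Cauchy_Schwarz_ineq2)
      also have "\<dots> \<le> (\<zeta> + \<delta>) * \<zeta>"
        using x e \<zeta> \<delta> norm_triangle_ineq4[of x a] by (intro mult_mono) (auto simp: a_def)
      finally have "\<bar>1 - h v\<bar> * \<bar>(x - a) \<bullet> x\<bar> \<le> 1 * ((\<zeta> + \<delta>) * \<zeta>)"
        using h[of v] by (intro mult_mono) auto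
      then show ?thesis by (simp add: abs_mult)
    qed
    then have "\<bar>lam * ((1 - h v) * ((x - a) \<bullet> x))\<bar> \<le> lam * ((\<zeta> + \<delta>) * \<zeta>)"
      using lam by (simp add: abs_mult)
    moreover have "\<bar>(lam - d * \<sigma>\<^sup>2) * (a \<bullet> x)\<bar> \<le> (lam + d * \<sigma>\<^sup>2) * \<delta> * norm x"
    proof -
      have "\<bar>a \<bullet> x\<bar> \<le> norm a * norm x" by (rule Cauchy_Schwarz_ineq2)
      also have "\<dots> \<le> \<delta> * norm x" using e by (intro mult_right_mono) (auto simp: a_def)
      finally have "\<bar>lam - d * \<sigma>\<^sup>2\<bar> * \<bar>a \<bullet> x\<bar> \<le> (lam + d * \<sigma>\<^sup>2) * (\<delta> * norm x)"
        using lam d by (intro mult_mono) (auto simp: abs_le_iff)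
      then show ?thesis by (simp add: abs_mult mult.assoc)
    qed
    moreover have "0 \<le> d * \<sigma>\<^sup>2 / 2 * (norm a)\<^sup>2" using d by simp
    moreover have "d * \<sigma>\<^sup>2 / 2 * (norm a)\<^sup>2 \<le> d * \<sigma>\<^sup>2 / 2 * \<delta>\<^sup>2"
      using d e by (intro mult_left_mono power_mono) (auto simp: a_def)
    ultimately show ?thesis unfolding x_def[symmetric] by linarith
  qed
  have eq: "- lam * (\<integral>v. h v * ((v - e) \<bullet> (v - vs)) \<partial>\<mu>) + \<sigma>\<^sup>2 / 2 * (\<integral>v. (norm (v - e))\<^sup>2 * d \<partial>\<mu>)
      + (2 * lam - d * \<sigma>\<^sup>2) * half_second_moment vs \<mu> = (\<integral>v. ?F v \<partial>\<mu>)"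
    using int i2 by (simp add: half_second_moment_def)
  have "\<bar>\<integral>v. ?F v \<partial>\<mu>\<bar> \<le> (\<integral>v. \<bar>?F v\<bar> \<partial>\<mu>)" by (rule integral_abs_bound)
  also have "\<dots> \<le> (\<integral>v. lam * ((\<zeta> + \<delta>) * \<zeta>) + d * \<sigma>\<^sup>2 / 2 * \<delta>\<^sup>2
      + (lam + d * \<sigma>\<^sup>2) * \<delta> * norm (v - vs) \<partial>\<mu>)"
  proof (rule integral_mono)
    show "integrable \<mu> (\<lambda>v. \<bar>?F v\<bar>)" using iF by (rule integrable_abs)
    show "integrable \<mu> (\<lambda>v. lam * ((\<zeta> + \<delta>) * \<zeta>) + d * \<sigma>\<^sup>2 / 2 * \<delta>\<^sup>2
        + (lam + d * \<sigma>\<^sup>2) * \<delta> * norm (v - vs))"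
      using integrable_norm_diff(1)[OF \<mu>, of vs]
      by (intro Bochner_Integration.integrable_add integrable_mult_right) auto
  qed (rule pt)
  also have "\<dots> = lam * ((\<zeta> + \<delta>) * \<zeta>) + d * \<sigma>\<^sup>2 / 2 * \<delta>\<^sup>2
      + (lam + d * \<sigma>\<^sup>2) * \<delta> * (\<integral>v. norm (v - vs) \<partial>\<mu>)"
    using integrable_norm_diff(1)[OF \<mu>] by (simp add: prob_space)
  also have "\<dots> \<le> lam * ((\<zeta> + \<delta>) * \<zeta>) + d * \<sigma>\<^sup>2 / 2 * \<delta>\<^sup>2
      + (lam + d * \<sigma>\<^sup>2) * \<delta> * (1 + 2 * half_second_moment vs \<mu>)"
    using lam d \<delta> integral_norm_diff_le[OF \<mu>, of vs] by (intro add_left_mono mult_left_mono) auto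
  finally show ?thesis unfolding eq by (simp only: ac_simps)
qed

text \<open>The generator bound integrated against \<mu>. The assumption \<open>int\<close> allows
  for an h built from a possibly non-measurable H; the definition of a weak solution provides
  it.\<close>

lemma cutoff_mass_drift_ge:
  fixes vs e :: "real^'n" and h :: "real^'n \<Rightarrow> real" and r :: real
  defines "\<phi> \<equiv> \<lambda>v. cutoff vs r v ^ 3"
  assumes \<mu>: "\<mu> \<in> prob_measures_p 4" and r: "r > 0"
    and pt: "\<And>v. - lam * (h v * ((v - e) \<bullet> gradient \<phi> v))
      + \<sigma>\<^sup>2 / 2 * ((norm (v - e))\<^sup>2 * laplacian \<phi> v) \<ge> - p * \<phi> v"
    and int: "integrable \<mu> (\<lambda>v. h v * ((v - e) \<bullet> gradient \<phi> v))"
  shows "- lam * (\<integral>v. h v * ((v - e) \<bullet> gradient \<phi> v) \<partial>\<mu>)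
      + \<sigma>\<^sup>2 / 2 * (\<integral>v. (norm (v - e))\<^sup>2 * laplacian \<phi> v \<partial>\<mu>) \<ge> - p * (\<integral>v. \<phi> v \<partial>\<mu>)"
proof -
  note * = prob_measures_p_D[OF \<mu>]
  have i\<phi>: "integrable \<mu> \<phi>" unfolding \<phi>_def by (rule integrable_cutoff[OF \<mu>])
  have "continuous_on UNIV (laplacian \<phi>)"
    unfolding \<phi>_def cutoff_test_function(3)[OF r] divide_inverse
    by (intro continuous_intros continuous_cutoff)
  then have "laplacian \<phi> \<in> borel_measurable \<mu>"
    by (rule continuous_imp_measurable_sets_borel[OF *(2)])
  moreover have "bounded (range (laplacian \<phi>))"
    using cutoff_test_function(1)[OF r, of vs] by (simp add: \<phi>_def test_functions_def)
  then obtain K where "\<And>v. \<bar>laplacian \<phi> v\<bar> \<le> K" by (auto simp: bounded_iff)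
  ultimately have iL: "integrable \<mu> (\<lambda>v. (norm (v - e))\<^sup>2 * laplacian \<phi> v)"
    by (rule integrable_bounded_times_quadratic[OF \<mu>])
  have "- p * (\<integral>v. \<phi> v \<partial>\<mu>) = (\<integral>v. - p * \<phi> v \<partial>\<mu>)" by simp
  also have "\<dots> \<le> (\<integral>v. - lam * (h v * ((v - e) \<bullet> gradient \<phi> v))
      + \<sigma>\<^sup>2 / 2 * ((norm (v - e))\<^sup>2 * laplacian \<phi> v) \<partial>\<mu>)"
    using i\<phi> int iL pt
    by (intro integral_mono Bochner_Integration.integrable_add integrable_mult_right) auto
  also have "\<dots> = - lam * (\<integral>v. h v * ((v - e) \<bullet> gradient \<phi> v) \<partial>\<mu>)
      + \<sigma>\<^sup>2 / 2 * (\<integral>v. (norm (v - e))\<^sup>2 * laplacian \<phi> v \<partial>\<mu>)"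
    using int iL by simp
  finally show ?thesis .
qed

lemma consensus_convergence:
  fixes E :: "real^'n \<Rightarrow> real" and vs :: "real^'n" and H :: "real \<Rightarrow> real"
    and \<rho>0 :: "(real^'n) measure" and \<epsilon> \<theta> lam \<sigma> Tstar :: real
  defines "\<kappa> \<equiv> 2 * lam - real CARD('n) * \<sigma>\<^sup>2"
  assumes cE: "continuous_on UNIV E" and A1: "cond_A1 E vs" and A2: "cond_A2 E vs"
    and \<rho>0: "\<rho>0 \<in> prob_measures_p 4" and supp: "vs \<in> measure_support \<rho>0"
    and \<epsilon>: "0 < \<epsilon>" "\<epsilon> < half_second_moment vs \<rho>0" and \<theta>: "0 < \<theta>" "\<theta> < 1"
    and lam: "lam > 0" and \<sigma>: "\<sigma> > 0" and \<kappa>: "\<kappa> > 0"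
    and Tstar: "Tstar = 1 / ((1 - \<theta>) * \<kappa>) * ln (half_second_moment vs \<rho>0 / \<epsilon>)"
    and H: "\<And>x. 0 \<le> H x" "\<And>x. H x \<le> 1" "\<And>x. x \<ge> 0 \<Longrightarrow> H x = 1"
  shows "\<exists>\<alpha>0>0. \<forall>\<alpha>>\<alpha>0. \<forall>\<rho>. fokker_planck_weak_solution E H \<alpha> lam \<sigma> Tstar \<rho>0 \<rho> \<longrightarrow>
    (\<exists>T\<in>{(1 - \<theta>) / (1 + \<theta> / 2) * Tstar..Tstar}. half_second_moment vs (\<rho> T) = \<epsilon> \<and>
      (\<forall>t\<in>{0..T}. (wasserstein 2 (\<rho> t) (return borel vs))\<^sup>2 = 2 * half_second_moment vs (\<rho> t) \<and>
        2 * half_second_moment vs (\<rho> t)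
          \<le> 2 * half_second_moment vs \<rho>0 * exp (- (1 - \<theta>) * \<kappa> * t)))"
proof -
  note min = cond_A1_minimizer(1)[OF A1]
  define V0 where "V0 = half_second_moment vs \<rho>0"
  define d where "d = real CARD('n)"
  have V0: "\<epsilon> < V0" "V0 > 0" using \<epsilon> by (auto simp: V0_def)
  have d: "d \<ge> 0" by (simp add: d_def)
  have T0: "Tstar > 0"
    unfolding Tstar V0_def[symmetric] using V0 \<epsilon> \<theta> \<kappa> by simp
  have near: "\<exists>r>0. \<forall>v. norm (v - vs) < r \<longrightarrow> E v \<le> E vs + q" if q: "q > 0" for q
  proof -
    obtain r where "r > 0" "\<And>v. dist v vs < r \<Longrightarrow> dist (E v) (E vs) < q"
      using cE q unfolding continuous_on_iff by blast
    then show ?thesis by (intro exI[of _ r]) (force simp: dist_real_def dist_norm)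
  qed

  \<comment> \<open>The error budget for V': as long as V > \<epsilon>, it is at most the fraction
    \<theta>/2 of \<kappa> V. One half goes to the defect of H through \<zeta>, the other to the
    consensus point through \<delta>.\<close>
  define \<tau> where "\<tau> = \<theta> / 2 * \<kappa> * \<epsilon>"
  have \<tau>: "\<tau> > 0" using \<theta> \<kappa> \<epsilon> by (simp add: \<tau>_def)
  define \<zeta> where "\<zeta> = min 1 (\<tau> / (4 * lam))"
  have \<zeta>: "\<zeta> > 0" "\<zeta> \<le> 1" "2 * lam * \<zeta> \<le> \<tau> / 2"
  proof -
    have "2 * lam * \<zeta> \<le> 2 * lam * (\<tau> / (4 * lam))"
      unfolding \<zeta>_def using lam by (intro mult_left_mono) auto
    then show "2 * lam * \<zeta> \<le> \<tau> / 2" using lam by simp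
  qed (use \<tau> lam in \<open>auto simp: \<zeta>_def\<close>)
  obtain q1 where q1: "q1 > 0" "\<And>v. E v \<le> E vs + q1 \<Longrightarrow> norm (v - vs) \<le> \<zeta>"
    using cond_A2_sublevel[OF A1 A2 \<zeta>(1)] by blast
  obtain r1 where r1: "r1 > 0" "\<And>v. norm (v - vs) < r1 \<Longrightarrow> E v \<le> E vs + q1"
    using near[OF q1(1)] by blast
  \<comment> \<open>The sum of the coefficients of \<delta> in
    \<open>second_moment_drift_error\<close>, after V < 2 V0 and \<delta>^2 \<le> \<delta>.\<close>
  define c where "c = (lam + d * \<sigma>\<^sup>2) * (1 + 4 * V0) + d * \<sigma>\<^sup>2 / 2"
  have c: "c > 0" using lam d V0 by (simp add: c_def add_pos_nonneg)
  \<comment> \<open>The entry 1 gives \<delta>^2 \<le> \<delta> and \<zeta> + \<delta> \<le> 2, the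
    second meets the budget, and the third keeps the consensus point where E is at most E vs +
    q1.\<close>
  define \<delta> where "\<delta> = Min {1, \<tau> / (2 * c), r1 / 2}"
  have \<delta>: "\<delta> > 0" "\<delta> \<le> 1" "\<delta> < r1" "c * \<delta> \<le> \<tau> / 2"
  proof -
    have "c * \<delta> \<le> c * (\<tau> / (2 * c))"
      unfolding \<delta>_def using c by (intro mult_left_mono) auto
    then show "c * \<delta> \<le> \<tau> / 2" using c by simp
    have "\<delta> \<le> r1 / 2" unfolding \<delta>_def by (rule Min_le) auto
    then show "\<delta> < r1" using r1 by simp
  qed (use \<tau> c r1 in \<open>auto simp: \<delta>_def\<close>)

  \<comment> \<open>Half of \<delta> is for the sublevel set and half for the exponential tail. The
    Laplace estimate separates the levels q and 2 q, hence q = q2 / 2.\<close>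
  obtain q2 where q2: "q2 > 0" "\<And>v. E v \<le> E vs + q2 \<Longrightarrow> norm (v - vs) \<le> \<delta> / 2"
    using cond_A2_sublevel[OF A1 A2, of "\<delta> / 2"] \<delta>(1) by auto
  define q where "q = q2 / 2"
  have q: "q > 0" "\<And>v. E v \<le> E vs + 2 * q \<Longrightarrow> norm (v - vs) \<le> \<delta> / 2"
    using q2 by (auto simp: q_def)
  obtain r where r: "r > 0" "\<And>v. norm (v - vs) < r \<Longrightarrow> E v \<le> E vs + q"
    using near[OF q(1)] by blast
  define \<phi> where "\<phi> = (\<lambda>v. cutoff vs r v ^ 3)"
  define g0 where "g0 = (\<integral>v. \<phi> v \<partial>\<rho>0)"
  have g0: "g0 > 0" unfolding g0_def \<phi>_def by (rule integral_cutoff_pos[OF \<rho>0 supp r(1)])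
  obtain p where p: "p \<ge> 0" and gen: "\<And>e h v. norm (e - vs) \<le> \<delta> \<Longrightarrow> 0 \<le> h \<Longrightarrow> h \<le> 1 \<Longrightarrow>
    - lam * (h * ((v - e) \<bullet> gradient \<phi> v)) + \<sigma>\<^sup>2 / 2 * ((norm (v - e))\<^sup>2 * laplacian \<phi> v)
    \<ge> - p * \<phi> v"
    using generator_cutoff_ge[OF r(1) lam \<sigma>, of \<delta> vs] \<delta>(1) unfolding \<phi>_def by auto
  define m where "m = g0 * exp (- p * Tstar) / 2"
  have m: "m > 0" "m < g0 * exp (- p * Tstar)" using g0 by (auto simp: m_def)
  \<comment> \<open>For exp (- \<alpha> q) \<le> 1 / X the tail term of
    \<open>consensus_point_deviation\<close> is at most \<delta> / 2 when V < 2 V0. Since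
    \<open>ln X\<close> may be negative, \<alpha>0 takes a maximum with 1.\<close>
  define X where "X = 2 * (1 + 4 * V0) / (m * \<delta>)"
  have X: "X > 0" using V0 m \<delta> by (simp add: X_def)
  define \<alpha>0 where "\<alpha>0 = max 1 (ln X / q)"

  have main: "\<exists>T\<in>{(1 - \<theta>) / (1 + \<theta> / 2) * Tstar..Tstar}. half_second_moment vs (\<rho> T) = \<epsilon> \<and>
      (\<forall>t\<in>{0..T}. (wasserstein 2 (\<rho> t) (return borel vs))\<^sup>2 = 2 * half_second_moment vs (\<rho> t) \<and>
        2 * half_second_moment vs (\<rho> t)
          \<le> 2 * half_second_moment vs \<rho>0 * exp (- (1 - \<theta>) * \<kappa> * t))"
    if \<alpha>: "\<alpha> > \<alpha>0" and sol: "fokker_planck_weak_solution E H \<alpha> lam \<sigma> Tstar \<rho>0 \<rho>" for \<alpha> \<rho>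
  proof -
    have curve: "\<rho> \<in> wasserstein_curves 4 Tstar"
      using sol by (simp add: fokker_planck_weak_solution_def)
    have \<rho>: "\<rho> t \<in> prob_measures_p 4" if "0 \<le> t" "t \<le> Tstar" for t
      using curve that by (auto simp: wasserstein_curves_def)
    define e where "e t = consensus_point E \<alpha> (\<rho> t)" for t
    define h where "h t v = H (E v - E (e t))" for t v
    define D where "D \<psi> t = - lam * (\<integral>v. h t v * ((v - e t) \<bullet> gradient \<psi> v) \<partial>(\<rho> t))
      + \<sigma>\<^sup>2 / 2 * (\<integral>v. (norm (v - e t))\<^sup>2 * laplacian \<psi> v \<partial>(\<rho> t))" for \<psi> t
    have weak: "integrable (\<rho> t) (\<lambda>v. h t v * ((v - e t) \<bullet> gradient \<psi> v))"
      "((\<lambda>s. \<integral>v. \<psi> v \<partial>(\<rho> s)) has_real_derivative D \<psi> t) (at t)"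
      if "\<psi> \<in> test_functions" "0 < t" "t < Tstar" for \<psi> t
      using sol that unfolding fokker_planck_weak_solution_def D_def h_def e_def by auto
    have init: "((\<lambda>t. \<integral>v. \<psi> v \<partial>(\<rho> t)) \<longlongrightarrow> (\<integral>v. \<psi> v \<partial>\<rho>0)) (at_right 0)"
      if "\<psi> \<in> test_functions" for \<psi>
      using sol that unfolding fokker_planck_weak_solution_def by auto
    define V where "V t = half_second_moment vs (\<rho> t)" for t
    define sq where "sq = (\<lambda>v. (norm (v - vs))\<^sup>2 / 2)"
    have V_eq: "V = (\<lambda>t. \<integral>v. sq v \<partial>(\<rho> t))" by (simp add: V_def sq_def half_second_moment_def fun_eq_iff)
    note sq = quadratic_test_function[of vs, folded sq_def]
    note \<phi>t = cutoff_test_function[OF r(1), of vs, folded \<phi>_def]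
    have cV: "continuous_on {0..Tstar} V"
      unfolding continuous_on_def V_def using tendsto_half_second_moment[OF curve] by blast
    \<comment> \<open>The initial condition is a limit of integrals and does not identify
      \<open>\<rho> 0\<close> with \<open>\<rho>0\<close>; continuity of V along the curve yields
      equality of the moments.\<close>
    have V_0: "V 0 = V0"
    proof (rule tendsto_unique)
      show "(V \<longlongrightarrow> V0) (at_right 0)"
        using init[OF sq(1)] unfolding V_eq V0_def half_second_moment_def sq_def by simp
      have "(V \<longlongrightarrow> V 0) (at 0 within {0..Tstar})" using cV T0 by (auto simp: continuous_on_def)
      then show "(V \<longlongrightarrow> V 0) (at_right 0)" using T0 by (simp add: at_within_Icc_at_right)
    qed simp
    \<comment> \<open>Redefining the mass at time 0 as its limit makes it continuous there by the
      initial condition.\<close>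
    define g where "g t = (if t = 0 then g0 else \<integral>v. \<phi> v \<partial>(\<rho> t))" for t
    have dg: "(g has_real_derivative D \<phi> t) (at t)" if "0 < t" "t < Tstar" for t
      by (rule has_field_derivative_transform_within_open[OF weak(2)[OF \<phi>t(1) that], of "{0<..}"])
        (use that in \<open>auto simp: g_def\<close>)
    have cg: "continuous_on {0..<Tstar} g"
      unfolding continuous_on_def
    proof
      fix t assume t: "t \<in> {0..<Tstar}"
      show "(g \<longlongrightarrow> g t) (at t within {0..<Tstar})"
      proof (cases "t = 0")
        case True
        have "(g \<longlongrightarrow> g0) (at_right 0)"
          using init[OF \<phi>t(1)] unfolding g0_def[symmetric]
          by (rule Lim_transform_eventually)
            (auto simp: g_def eventually_at_filter intro!: always_eventually)
        then have "(g \<longlongrightarrow> g0) (at 0 within {0..Tstar})"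
          using T0 by (simp add: at_within_Icc_at_right)
        then have "(g \<longlongrightarrow> g0) (at 0 within {0..<Tstar})"
          by (rule tendsto_within_subset) auto
        then show ?thesis using True by (simp add: g_def)
      next
        case False
        then have "isCont g t" using t by (intro DERIV_isCont[OF dg]) auto
        then have "(g \<longlongrightarrow> g t) (at t)" by (simp add: isCont_def)
        then show ?thesis by (rule tendsto_within_subset) auto
      qed
    qed
    have boot: "D \<phi> t \<ge> - p * g t \<and> D sq t \<ge> - ((1 + \<theta>/2) * \<kappa>) * V t \<and>
        D sq t \<le> - ((1 - \<theta>) * \<kappa>) * V t"
      if t: "0 < t" "t < Tstar" and gt: "m < g t" and Vt: "\<epsilon> < V t" "V t < 2 * V 0" for t
    proof -
      have \<mu>: "\<rho> t \<in> prob_measures_p 4" using \<rho> t by simp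
      have "ln X \<le> \<alpha> * q" using \<alpha> q(1) by (simp add: \<alpha>0_def field_simps)
      then have "exp (- \<alpha> * q) \<le> exp (- ln X)" by simp
      also have "\<dots> = 1 / X" using X by (simp add: exp_minus field_simps)
      finally have "exp (- \<alpha> * q) * (1 + 2 * V t) \<le> 1 / X * (1 + 4 * V0)"
        using Vt V_0 V0 X \<epsilon> by (intro mult_mono) auto
      also have "\<dots> = m * \<delta> / 2"
      proof -
        have "1 / (2 * k / y) * k = y / 2" if "k > 0" for k y :: real using that by simp
        from this[of "1 + 4 * V0"] show ?thesis using V0 by (simp only: X_def)
      qed
      finally have "exp (- \<alpha> * q) * (1 + 2 * V t) / m \<le> \<delta> / 2"
        using m by (simp add: field_simps)
      moreover have "norm (e t - vs) \<le> \<delta> / 2 + exp (- \<alpha> * q) * (1 + 2 * V t) / m"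
        unfolding e_def V_def
      proof (rule consensus_point_deviation[OF \<mu> cE min _ r(1) _ q(2) r(2) m(1)])
        show "m \<le> (\<integral>v. cutoff vs r v ^ 3 \<partial>\<rho> t)" using gt t by (simp add: g_def \<phi>_def)
      qed (use \<alpha> \<delta> in \<open>auto simp: \<alpha>0_def\<close>)
      ultimately have e: "norm (e t - vs) \<le> \<delta>" by linarith
      have h: "0 \<le> h t v" "h t v \<le> 1" for v using H by (auto simp: h_def)
      have "D \<phi> t \<ge> - p * (\<integral>v. \<phi> v \<partial>\<rho> t)"
        unfolding D_def \<phi>_def
        by (rule cutoff_mass_drift_ge[OF \<mu> r(1)])
          (use gen[OF e h] weak(1)[OF \<phi>t(1) t] in \<open>auto simp: \<phi>_def\<close>)
      then have 1: "D \<phi> t \<ge> - p * g t" using t by (simp add: g_def)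
      \<comment> \<open>Where H differs from 1, E v < E (e t) \<le> E vs + q1, so v lies in the
        sublevel set of q1.\<close>
      have hn: "norm (v - vs) \<le> \<zeta>" if "h t v \<noteq> 1" for v
      proof -
        have "\<not> E v - E (e t) \<ge> 0" using H(3) that by (auto simp: h_def)
        moreover have "E (e t) \<le> E vs + q1" using r1(2) e \<delta>(3) by simp
        ultimately show ?thesis by (intro q1(2)) simp
      qed
      have "\<bar>D sq t + \<kappa> * V t\<bar> \<le> lam * ((\<zeta> + \<delta>) * \<zeta>)
          + (lam + d * \<sigma>\<^sup>2) * \<delta> * (1 + 2 * V t) + d * \<sigma>\<^sup>2 / 2 * \<delta>\<^sup>2"
        unfolding D_def sq(2,3) V_def \<kappa>_def d_def[symmetric]
        using weak(1)[OF sq(1) t] \<zeta>(1)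
        by (intro second_moment_drift_error[OF \<mu> lam h hn _ e _ d]) (simp_all add: sq(2))
      also have "\<dots> \<le> lam * (2 * \<zeta>) + (lam + d * \<sigma>\<^sup>2) * \<delta> * (1 + 4 * V0) + d * \<sigma>\<^sup>2 / 2 * \<delta>"
      proof (intro add_mono mult_left_mono)
        show "(\<zeta> + \<delta>) * \<zeta> \<le> 2 * \<zeta>" using \<zeta> \<delta> by (intro mult_right_mono) auto
        show "\<delta>\<^sup>2 \<le> \<delta>" using \<delta> by (simp add: power2_eq_square mult_left_le)
      qed (use lam d \<delta> Vt V_0 in auto)
      also have "\<dots> = 2 * lam * \<zeta> + c * \<delta>" by (simp add: c_def algebra_simps)
      also have "\<dots> \<le> \<tau>" using \<zeta>(3) \<delta>(4) by simp
      also have "\<tau> \<le> \<theta> / 2 * \<kappa> * V t"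
        unfolding \<tau>_def using \<theta> \<kappa> Vt by (intro mult_left_mono) auto
      finally have *: "\<bar>D sq t + \<kappa> * V t\<bar> \<le> \<theta> / 2 * \<kappa> * V t" .
      \<comment> \<open>The budget gives decay at rate (1 - \<theta>/2) \<kappa>, weakened here to
        (1 - \<theta>) \<kappa>, the rate that defines \<open>Tstar\<close>.\<close>
      have "\<theta> / 2 * \<kappa> * V t \<le> \<theta> * \<kappa> * V t"
        using \<theta> \<kappa> Vt \<epsilon> by (intro mult_right_mono) auto
      then have "- ((1 + \<theta>/2) * \<kappa>) * V t \<le> D sq t" "D sq t \<le> - ((1 - \<theta>) * \<kappa>) * V t"
        using * unfolding abs_le_iff by (auto simp: algebra_simps)
      then show ?thesis using 1 by simp
    qed
    have "\<exists>T\<in>{(1 - \<theta>) / (1 + \<theta>/2) * Tstar..Tstar}. V T = \<epsilon> \<and>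
      (\<forall>t\<in>{0..T}. V t \<le> V 0 * exp (- (1 - \<theta>) * \<kappa> * t))"
    proof (rule bootstrap_decay[OF \<kappa> \<theta> \<epsilon>(1) _ _ p _ _ cg cV dg _ boot])
      show "\<epsilon> < V 0" using V0 V_0 by simp
      show "Tstar = 1 / ((1 - \<theta>) * \<kappa>) * ln (V 0 / \<epsilon>)" using Tstar V_0 V0_def by simp
      show "m < g 0 * exp (- p * Tstar)" "g 0 > 0" using m g0 by (auto simp: g_def)
      show "(V has_real_derivative D sq t) (at t)" if "0 < t" "t < Tstar" for t
        unfolding V_eq by (rule weak(2)[OF sq(1) that])
    qed
    then obtain T where T: "T \<in> {(1 - \<theta>) / (1 + \<theta>/2) * Tstar..Tstar}" "V T = \<epsilon>"
      "\<And>t. t \<in> {0..T} \<Longrightarrow> V t \<le> V 0 * exp (- (1 - \<theta>) * \<kappa> * t)" by blast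
    show ?thesis
    proof (intro bexI[OF _ T(1)] conjI ballI)
      show "half_second_moment vs (\<rho> T) = \<epsilon>" using T(2) by (simp add: V_def)
      fix t assume t: "t \<in> {0..T}"
      then show "(wasserstein 2 (\<rho> t) (return borel vs))\<^sup>2 = 2 * half_second_moment vs (\<rho> t)"
        using T(1) by (intro wasserstein_2_return \<rho>) auto
      show "2 * half_second_moment vs (\<rho> t)
          \<le> 2 * half_second_moment vs \<rho>0 * exp (- (1 - \<theta>) * \<kappa> * t)"
        using T(3)[OF t] unfolding V_0 unfolding V_def V0_def by simp
    qed
  qed
  have "\<alpha>0 > 0" by (simp add: \<alpha>0_def)
  then show ?thesis using main by blast
qed

theorem theorem3p7:
  fixes E :: "real^'n \<Rightarrow> real" and vs :: "real^'n"
    and \<rho>0 :: "(real^'n) measure"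
    and \<epsilon> \<theta> lam \<sigma> Tstar :: real
  assumes "continuous_on UNIV E"
    and "cond_A1 E vs"
    and "cond_A2 E vs"
    and "\<rho>0 \<in> prob_measures_p 4"
    and "vs \<in> measure_support \<rho>0"
    and "\<epsilon> \<in> {0<..<half_second_moment vs \<rho>0}"
    and "\<theta> \<in> {0<..<1}"
    and "lam > 0" and "\<sigma> > 0" and "2 * lam > real CARD('n) * \<sigma>\<^sup>2"
    and "Tstar = 1 / ((1 - \<theta>) * (2 * lam - real CARD('n) * \<sigma>\<^sup>2))
                   * ln (half_second_moment vs \<rho>0 / \<epsilon>)"
  shows
    "(\<exists>\<alpha>0>0. \<forall>\<alpha>>\<alpha>0. \<forall>\<rho>.
        fokker_planck_weak_solution E (\<lambda>_. 1) \<alpha> lam \<sigma> Tstar \<rho>0 \<rho> \<longrightarrow>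
        (\<exists>T\<in>{(1 - \<theta>) / (1 + \<theta> / 2) * Tstar..Tstar}.
           half_second_moment vs (\<rho> T) = \<epsilon> \<and>
           (\<forall>t\<in>{0..T}.
              (wasserstein 2 (\<rho> t) (return borel vs))\<^sup>2 = 2 * half_second_moment vs (\<rho> t) \<and>
              2 * half_second_moment vs (\<rho> t)
                \<le> 2 * half_second_moment vs \<rho>0
                    * exp (- (1 - \<theta>) * (2 * lam - real CARD('n) * \<sigma>\<^sup>2) * t))))
     \<and>
     (cond_A3 E vs \<longrightarrow>
      (\<forall>H :: real \<Rightarrow> real. (\<forall>x. H x \<in> {0..1}) \<and> (\<forall>x\<ge>0. H x = 1) \<longrightarrow>
       (\<exists>\<alpha>0>0. \<forall>\<alpha>>\<alpha>0. \<forall>\<rho>.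
          fokker_planck_weak_solution E H \<alpha> lam \<sigma> Tstar \<rho>0 \<rho> \<longrightarrow>
          (\<exists>T\<in>{(1 - \<theta>) / (1 + \<theta> / 2) * Tstar..Tstar}.
             half_second_moment vs (\<rho> T) = \<epsilon> \<and>
             (\<forall>t\<in>{0..T}.
                (wasserstein 2 (\<rho> t) (return borel vs))\<^sup>2 = 2 * half_second_moment vs (\<rho> t) \<and>
                2 * half_second_moment vs (\<rho> t)
                  \<le> 2 * half_second_moment vs \<rho>0
                      * exp (- (1 - \<theta>) * (2 * lam - real CARD('n) * \<sigma>\<^sup>2) * t))))))"
proof -
  have \<epsilon>: "0 < \<epsilon>" "\<epsilon> < half_second_moment vs \<rho>0" and \<theta>: "0 < \<theta>" "\<theta> < 1"
    and \<kappa>: "2 * lam - real CARD('n) * \<sigma>\<^sup>2 > 0"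
    using assms by auto
  note main = consensus_convergence[OF assms(1-5) \<epsilon> \<theta> assms(8,9) \<kappa> assms(11)]
  show ?thesis
  proof (intro conjI impI allI, goal_cases)
    case 1
    show ?case by (rule main) auto
  next
    case (2 H)
    then show ?case by (intro main) auto
  qed
qed

end
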